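(* Let $p$ be a prime with $p\equiv 1\pmod 3$, $\mathcal{R}=\mathbb{F}_p+u\mathbb{F}_p+u^2\mathbb{F}_p+u^3\mathbb{F}_p$ with $u^4=u$, and $\eta_1,\dots,\eta_4$ the idempotents defined below. Let $\mathcal{C}=\eta_1\mathcal{C}_1\oplus\eta_2\mathcal{C}_2\oplus\eta_3\mathcal{C}_3\oplus\eta_4\mathcal{C}_4$ be a $(1-2u^3)$-constacyclic code of length $n$ over $\mathcal{R}$ (so $\mathcal{C}_1$ is cyclic and $\mathcal{C}_2,\mathcal{C}_3,\mathcal{C}_4$ are negacyclic over $\mathbb{F}_p$), and let $g_1,g_2,g_3,g_4\in\mathbb{F}_p[x]$ be the monic generator polynomials of $\mathcal{C}_1,\dots,\mathcal{C}_4$ respectively. Then: (i) $\mathcal{C}=\langle\eta_1g_1(x),\eta_2g_2(x),\eta_3g_3(x),\eta_4g_4(x)\rangle$, and $g(x)=\eta_1g_1(x)+\eta_2g_2(x)+\eta_3g_3(x)+\eta_4g_4(x)$ is the unique polynomial such that $\mathcal{C}=\langle g(x)\rangle$. (ii) $|\mathcal{C}|=p^{4n-\sum_{i=1}^4\deg g_i}$. (iii) If $g_1(x)h_1(x)=x^n-1$ and $g_i(x)h_i(x)=x^n+1$ for $2\le i\le 4$, and $h(x)=\eta_1h_1(x)+\eta_2h_2(x)+\eta_3h_3(x)+\eta_4h_4(x)$, then $g(x)h(x)=x^n-(1-2u^3)$. (iv) With $h_i,h$ as in (iii), if $f_1,\dots,f_4\in\mathbb{F}_p[x]$ satisfy $\gcd(f_i(x),h_i(x))=1$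 for $1\le i\le 4$ and $f(x)=\eta_1f_1(x)+\eta_2f_2(x)+\eta_3f_3(x)+\eta_4f_4(x)$, then $\gcd(f(x),h(x))=1$ and $\mathcal{C}=\langle g(x)f(x)\rangle$. (v) $\mathcal{C}^\perp=\eta_1\mathcal{C}_1^\perp\oplus\eta_2\mathcal{C}_2^\perp\oplus\eta_3\mathcal{C}_3^\perp\oplus\eta_4\mathcal{C}_4^\perp$. (vi) $\mathcal{C}^\perp=\langle h^\perp(x)\rangle$, where $h^\perp(x)=\eta_1h_1^\perp(x)+\eta_2h_2^\perp(x)+\eta_3h_3^\perp(x)+\eta_4h_4^\perp(x)$ and $h_i^\perp$ is the reciprocal polynomial of $h_i$ (with $h_i$ as in (iii)). (vii) $|\mathcal{C}^\perp|=p^{\sum_{i=1}^4\deg g_i}$. (viii) If $r_1$ denotes the number of irreducible factors of $x^n-1$ over $\mathbb{F}_p$ and $r_2$ the number of irreducible factors of $x^n+1$ over $\mathbb{F}_p$, then the number of $(1-2u^3)$-constacyclic codes of length $n$ over $\mathcal{R}$ is $2^{r_1}8^{r_2}$. (ix) $\mathcal{C}$ is self-dual if and only if $\mathcal{C}_1,\mathcal{C}_2,\mathcal{C}_3,\mathcal{C}_4$ are self-dual.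
   Context: Let $\xi\in\mathbb{F}_p$ be a primitive cube root of unity. Set $\eta_1=1-u^3$, $\eta_2=3^{-1}(u+u^2+u^3)$, $\eta_3=3^{-1}(\xi u+\xi^2u^2+u^3)$, $\eta_4=3^{-1}(\xi^2u+\xi u^2+u^3)$: pairwise orthogonal idempotents of $\mathcal{R}$ summing to $1$. For a linear code $\mathcal{C}\subseteq\mathcal{R}^n$, $\mathcal{C}_j$ ($j=1,\dots,4$) is the set of $x_j\in\mathbb{F}_p^n$ for which there exist the other three vectors $x_k\in\mathbb{F}_p^n$ with $\sum_k\eta_kx_k\in\mathcal{C}$. A $(1-2u^3)$-constacyclic code of length $n$ over $\mathcal{R}$ is identified with an ideal of $\mathcal{R}[x]/\langle x^n-(1-2u^3)\rangle$; cyclic (resp. negacyclic) codes over $\mathbb{F}_p$ with ideals of $\mathbb{F}_p[x]/\langle x^n-1\rangle$ (resp. $\mathbb{F}_p[x]/\langle x^n+1\rangle$), whose monic generator polynomial divides $x^n-1$ (resp. $x^n+1$). $\langle\cdot\rangle$ denotes the ideal generated. Duals are with respect to the Euclidean inner product; self-dual means $\mathcal{C}=\mathcal{C}^\perp$.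
   Formalization: In (i), g is proved unique only among sums of η_i q_i with q_1 a monic divisor of x^n-1 and q_2,q_3,q_4 monic divisors of x^n+1 (2g generates the same ideal); (viii) is proved only for gcd(n,p)=1, since it fails whenever p divides n (e.g. p=n=7). *)

theory Defs
  imports
    "Berlekamp_Zassenhaus.Finite_Field"
    "Jordan_Normal_Form.Matrix"
    "HOL-Computational_Algebra.Polynomial_Factorial"
    "HOL-Number_Theory.Cong"
begin

section \<open>The ring \<open>R = F + u F + u^2 F + u^3 F\<close> with \<open>u^4 = u\<close>\<close>

text \<open>\<open>UR a b c d\<close> stands for \<open>a + b u + c u^2 + d u^3\<close>; products are reduced by
  \<open>u^4 = u\<close>, \<open>u^5 = u^2\<close>, \<open>u^6 = u^3\<close>.\<close>

datatype 'a ur = UR (ur0: 'a) (ur1: 'a) (ur2: 'a) (ur3: 'a)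

instantiation ur :: (comm_ring_1) comm_ring_1
begin

definition zero_ur :: "'a ur" where "0 = UR 0 0 0 0"
definition one_ur :: "'a ur" where "1 = UR 1 0 0 0"
definition plus_ur :: "'a ur \<Rightarrow> 'a ur \<Rightarrow> 'a ur" where
  "x + y = UR (ur0 x + ur0 y) (ur1 x + ur1 y) (ur2 x + ur2 y) (ur3 x + ur3 y)"
definition minus_ur :: "'a ur \<Rightarrow> 'a ur \<Rightarrow> 'a ur" where
  "x - y = UR (ur0 x - ur0 y) (ur1 x - ur1 y) (ur2 x - ur2 y) (ur3 x - ur3 y)"
definition uminus_ur :: "'a ur \<Rightarrow> 'a ur" where
  "- x = UR (- ur0 x) (- ur1 x) (- ur2 x) (- ur3 x)"
definition times_ur :: "'a ur \<Rightarrow> 'a ur \<Rightarrow> 'a ur" where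
  "x * y = UR
     (ur0 x * ur0 y)
     (ur0 x * ur1 y + ur1 x * ur0 y + (ur1 x * ur3 y + ur2 x * ur2 y + ur3 x * ur1 y))
     (ur0 x * ur2 y + ur1 x * ur1 y + ur2 x * ur0 y + (ur2 x * ur3 y + ur3 x * ur2 y))
     (ur0 x * ur3 y + ur1 x * ur2 y + ur2 x * ur1 y + ur3 x * ur0 y + ur3 x * ur3 y)"

instance
  by standard
    (auto simp: zero_ur_def one_ur_def plus_ur_def minus_ur_def uminus_ur_def times_ur_def
      algebra_simps intro: ur.expand)

end

definition ur_u :: "'a::comm_ring_1 ur" where "ur_u = UR 0 1 0 0"

definition ur_of :: "'a::comm_ring_1 \<Rightarrow> 'a ur" where "ur_of a = UR a 0 0 0"

lemma ur_u_power4: "(ur_u :: 'a::comm_ring_1 ur) ^ 4 = ur_u"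
  by (simp add: ur_u_def times_ur_def one_ur_def eval_nat_numeral)

lemma UR_eq: "UR a b c d = ur_of a + ur_of b * ur_u + ur_of c * ur_u ^ 2 + ur_of d * ur_u ^ 3"
  by (simp add: ur_u_def ur_of_def times_ur_def plus_ur_def one_ur_def eval_nat_numeral)

definition primitive_root_of_unity :: "nat \<Rightarrow> 'a::comm_ring_1 \<Rightarrow> bool" where
  "primitive_root_of_unity k z \<longleftrightarrow> 0 < k \<and> z ^ k = 1 \<and> (\<forall>m. 0 < m \<and> m < k \<longrightarrow> z ^ m \<noteq> 1)"

text \<open>The idempotents; only the indices 1, 2, 3, 4 are meaningful.\<close>

definition eta :: "'a::field \<Rightarrow> nat \<Rightarrow> 'a ur" where
  "eta z j =
    (if j = 1 then 1 - ur_u ^ 3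
     else if j = 2 then ur_of (inverse 3) * (ur_u + ur_u ^ 2 + ur_u ^ 3)
     else if j = 3 then ur_of (inverse 3) * (ur_of z * ur_u + ur_of (z ^ 2) * ur_u ^ 2 + ur_u ^ 3)
     else if j = 4 then ur_of (inverse 3) * (ur_of (z ^ 2) * ur_u + ur_of z * ur_u ^ 2 + ur_u ^ 3)
     else 0)"


section \<open>Linear and constacyclic codes\<close>

definition linear_code :: "nat \<Rightarrow> 'a::comm_ring_1 vec set \<Rightarrow> bool" where
  "linear_code n C \<longleftrightarrow> C \<subseteq> carrier_vec n \<and> 0\<^sub>v n \<in> C \<and>
     (\<forall>v\<in>C. \<forall>w\<in>C. v + w \<in> C) \<and> (\<forall>a. \<forall>v\<in>C. a \<cdot>\<^sub>v v \<in> C)"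

definition constashift :: "'a::comm_ring_1 \<Rightarrow> 'a vec \<Rightarrow> 'a vec" where
  "constashift l c =
     vec (dim_vec c) (\<lambda>i. if i = 0 then l * c $ (dim_vec c - 1) else c $ (i - 1))"

definition constacyclic :: "'a::comm_ring_1 \<Rightarrow> nat \<Rightarrow> 'a vec set \<Rightarrow> bool" where
  "constacyclic l n C \<longleftrightarrow> linear_code n C \<and> (\<forall>c\<in>C. constashift l c \<in> C)"

abbreviation cyclic :: "nat \<Rightarrow> 'a::comm_ring_1 vec set \<Rightarrow> bool" where
  "cyclic \<equiv> constacyclic 1"

abbreviation negacyclic :: "nat \<Rightarrow> 'a::comm_ring_1 vec set \<Rightarrow> bool" where
  "negacyclic \<equiv> constacyclic (- 1)"

definition poly_of_code :: "'a::comm_ring_1 vec \<Rightarrow> 'a poly" where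
  "poly_of_code c = (\<Sum>i<dim_vec c. monom (c $ i) i)"

text \<open>The modulus \<open>x^n - l\<close>.\<close>

definition xn_minus :: "'a::comm_ring_1 \<Rightarrow> nat \<Rightarrow> 'a poly" where
  "xn_minus l n = monom 1 n - [:l:]"

text \<open>\<open>module.span (*) S\<close> is the ideal generated by \<open>S\<close>. Hence \<open>c\<close> lies in
  \<open>code_gen l n S\<close> iff the residue class of \<open>poly_of_code c\<close> lies in the ideal of
  \<open>R[x]/\<langle>x^n - l\<rangle>\<close> generated by the residue classes of the elements of \<open>S\<close>.\<close>

definition code_gen :: "'a::comm_ring_1 \<Rightarrow> nat \<Rightarrow> 'a poly set \<Rightarrow> 'a vec set" where
  "code_gen l n S =
     {c \<in> carrier_vec n. poly_of_code c \<in> module.span (*) (insert (xn_minus l n) S)}"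

definition generator_poly :: "'a::field \<Rightarrow> nat \<Rightarrow> 'a vec set \<Rightarrow> 'a poly \<Rightarrow> bool" where
  "generator_poly l n C g \<longleftrightarrow> monic g \<and> g dvd xn_minus l n \<and> C = code_gen l n {g}"

definition dual_code :: "nat \<Rightarrow> 'a::comm_ring_1 vec set \<Rightarrow> 'a vec set" where
  "dual_code n C = {v \<in> carrier_vec n. \<forall>c\<in>C. v \<bullet> c = 0}"

definition self_dual :: "nat \<Rightarrow> 'a::comm_ring_1 vec set \<Rightarrow> bool" where
  "self_dual n C \<longleftrightarrow> C = dual_code n C"


section \<open>Decomposition along the idempotents\<close>

definition eta_vec :: "'a::field \<Rightarrow> nat \<Rightarrow> 'a vec \<Rightarrow> 'a ur vec" where
  "eta_vec z j x = eta z j \<cdot>\<^sub>v map_vec ur_of x"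

definition eta_poly :: "'a::field \<Rightarrow> nat \<Rightarrow> 'a poly \<Rightarrow> 'a ur poly" where
  "eta_poly z j q = smult (eta z j) (map_poly ur_of q)"

definition eta_poly_sum :: "'a::field \<Rightarrow> (nat \<Rightarrow> 'a poly) \<Rightarrow> 'a ur poly" where
  "eta_poly_sum z q = (\<Sum>j=1..4. eta_poly z j (q j))"

definition component :: "'a::field \<Rightarrow> nat \<Rightarrow> 'a ur vec set \<Rightarrow> nat \<Rightarrow> 'a vec set" where
  "component z n C j = {x j | x. (\<forall>k\<in>{1..4}. x k \<in> carrier_vec n) \<and>
     eta_vec z 1 (x 1) + eta_vec z 2 (x 2) + eta_vec z 3 (x 3) + eta_vec z 4 (x 4) \<in> C}"

definition is_direct_sum4 :: "'b::plus set \<Rightarrow> (nat \<Rightarrow> 'b set) \<Rightarrow> bool" where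
  "is_direct_sum4 C M \<longleftrightarrow>
     C = {m 1 + m 2 + m 3 + m 4 | m. \<forall>j\<in>{1..4::nat}. m j \<in> M j} \<and>
     (\<forall>m m'. (\<forall>j\<in>{1..4}. m j \<in> M j \<and> m' j \<in> M j) \<and>
        m 1 + m 2 + m 3 + m 4 = m' 1 + m' 2 + m' 3 + m' 4 \<longrightarrow> (\<forall>j\<in>{1..4}. m j = m' j))"

text \<open>The constant \<open>l\<close> such that the \<open>j\<close>-th component is \<open>l\<close>-constacyclic:
  \<open>(1 - 2 u^3) \<eta>\<^sub>j\<close> is \<open>\<eta>\<^sub>1\<close> for \<open>j = 1\<close> and \<open>-\<eta>\<^sub>j\<close> otherwise.\<close>

definition comp_const :: "nat \<Rightarrow> 'a::comm_ring_1" where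
  "comp_const j = (if j = 1 then 1 else - 1)"

text \<open>The library gcd does not apply to \<open>R[x]\<close>, which has zero divisors.\<close>

definition is_gcd :: "'a::comm_monoid_mult \<Rightarrow> 'a \<Rightarrow> 'a \<Rightarrow> bool" where
  "is_gcd d a b \<longleftrightarrow> d dvd a \<and> d dvd b \<and> (\<forall>e. e dvd a \<and> e dvd b \<longrightarrow> e dvd d)"

end

theory Submission
  imports Defs "HOL-Computational_Algebra.Squarefree"
begin

text \<open>Evaluating \<open>u\<close> at the four roots \<open>0, 1, \<xi>^2, \<xi>\<close> of \<open>X^4 - X\<close> identifies \<open>R\<close> with the
  product of four copies of the field, the \<open>\<eta>\<^sub>j\<close> being the coordinate idempotents. A linear code
  over \<open>R\<close> is therefore the same as four codes over the field, and polynomials, generated codes,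
  duals and cardinalities all split along the coordinates, where \<open>1 - 2 u^3\<close> becomes \<open>1\<close> or
  \<open>-1\<close>. This reduces every claim to the classical theory of \<open>l\<close>-constacyclic codes over a field
  with \<open>l^2 = 1\<close>.\<close>

section \<open>Words and polynomials\<close>

text \<open>Over a field the dual of an l-constacyclic code is in general 1/l-constacyclic, because
  reversing x^n - l gives -l (x^n - 1/l). Both constants that occur here satisfy l^2 = 1, so in
  every coordinate the code and its dual have the same modulus, and the dual over R is again
  generated modulo x^n - (1 - 2 u^3). A generator of \<open>C\<close> is far from unique as a mere
  polynomial: by (iv) the product g f generates \<open>C\<close> too when each f_i is coprime to
  h_i. Uniqueness in (i) is therefore taken among the \<open>eta_poly_sum\<close> of monic divisors
  of x^n - 1 and x^n + 1. Claim (viii) equates monic divisors with sets of irreducible factors,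
  which requires squarefree moduli. If p divides n, then x^n - l is the p-th power of x^(n/p) - l
  and has more divisors than that, whence the coprimality of n and p there.\<close>

lemma coeff_poly_of_code: "coeff (poly_of_code c) i = (if i < dim_vec c then c $ i else 0)"
  by (simp add: poly_of_code_def coeff_sum coeff_monom sum.delta)

lemma poly_of_code_vec_coeff:
  assumes "\<And>i. i \<ge> n \<Longrightarrow> coeff f i = 0"
  shows "poly_of_code (vec n (coeff f)) = f"
  using assms by (intro poly_eqI) (auto simp: coeff_poly_of_code)

lemma vec_coeff_poly_of_code: "c \<in> carrier_vec n \<Longrightarrow> vec n (coeff (poly_of_code c)) = c"
  by (intro eq_vecI) (auto simp: coeff_poly_of_code)

lemma poly_of_code_inject:
  "c \<in> carrier_vec n \<Longrightarrow> d \<in> carrier_vec n \<Longrightarrow> poly_of_code c = poly_of_code d \<Longrightarrow> c = d"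
  by (metis vec_coeff_poly_of_code)

lemma poly_of_code_zero: "poly_of_code (0\<^sub>v n) = 0"
  by (intro poly_eqI) (simp add: coeff_poly_of_code)

lemma poly_of_code_add:
  "v \<in> carrier_vec n \<Longrightarrow> w \<in> carrier_vec n \<Longrightarrow>
    poly_of_code (v + w) = poly_of_code v + poly_of_code w"
  by (intro poly_eqI) (simp add: coeff_poly_of_code)

lemma poly_of_code_smult: "poly_of_code (a \<cdot>\<^sub>v v) = smult a (poly_of_code v)"
  by (intro poly_eqI) (simp add: coeff_poly_of_code)

lemma degree_poly_of_code_less: "0 < dim_vec c \<Longrightarrow> degree (poly_of_code c) < dim_vec c"
  by (rule degree_lessI) (auto simp: coeff_poly_of_code)

lemma coeff_xn_minus:
  "coeff (xn_minus l n) i = (if i = n then 1 else 0) - (if i = 0 then l else 0)"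
  by (auto simp: xn_minus_def coeff_monom coeff_pCons split: nat.splits)

lemma
  assumes "n \<ge> 1"
  shows degree_xn_minus: "degree (xn_minus l n) = n"
    and monic_xn_minus: "monic (xn_minus l n)"
    and xn_minus_nonzero: "xn_minus l n \<noteq> 0"
proof -
  show deg: "degree (xn_minus l n) = n"
    using assms by (intro antisym degree_le le_degree) (auto simp: coeff_xn_minus)
  show "monic (xn_minus l n)"
    using assms unfolding deg by (simp add: coeff_xn_minus)
  then show "xn_minus l n \<noteq> 0" by auto
qed

lemma coeff_xn_minus_mult:
  "coeff (xn_minus l n * k) i = (if i < n then 0 else coeff k (i - n)) - l * coeff k i"
  by (simp add: xn_minus_def left_diff_distrib coeff_monom_mult)

lemma constashift_carrier: "c \<in> carrier_vec n \<Longrightarrow> constashift l c \<in> carrier_vec n"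
  unfolding constashift_def by simp

text \<open>Multiplication by x pushes the last letter to degree n; subtracting that multiple of x^n
  - l returns it, times l, to degree 0. This ties closure under the shift to closure under
  multiplication by x.\<close>

lemma poly_of_code_constashift:
  assumes "c \<in> carrier_vec n" "n \<ge> 1"
  shows "poly_of_code (constashift l c) =
    pCons 0 (poly_of_code c) - smult (c $ (n - 1)) (xn_minus l n)"
proof (rule poly_eqI)
  fix i show "coeff (poly_of_code (constashift l c)) i =
    coeff (pCons 0 (poly_of_code c) - smult (c $ (n - 1)) (xn_minus l n)) i"
    using assms
    by (cases i) (auto simp: coeff_poly_of_code constashift_def coeff_xn_minus mult.commute not_less
        dest: le_antisym)
qed

section \<open>Ideals and the codes they generate\<close>

lemma mult_module: "Modules.module ((*) :: 'a::comm_ring_1 \<Rightarrow> 'a \<Rightarrow> 'a)"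
  by unfold_locales (simp_all add: algebra_simps)

text \<open>Interpreting the locale globally would turn the reverse of associativity into a simplification
  rule, so the facts are instantiated one by one.\<close>

lemmas ideal_span_insert = Modules.module.span_insert[OF mult_module]
lemmas ideal_span_singleton = Modules.module.span_singleton[OF mult_module]
lemmas ideal_span_zero = Modules.module.span_zero[OF mult_module]
lemmas ideal_span_add = Modules.module.span_add[OF mult_module]
lemmas ideal_span_diff = Modules.module.span_diff[OF mult_module]
lemmas ideal_span_scale = Modules.module.span_scale[OF mult_module]
lemmas ideal_span_base = Modules.module.span_base[OF mult_module]
lemmas ideal_span_sum = Modules.module.span_sum[OF mult_module]
lemmas ideal_span_minimal = Modules.module.span_minimal[OF mult_module]
lemmas ideal_subspace_span = Modules.module.subspace_span[OF mult_module]

lemma mem_span_pair: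
  fixes f m s :: "'a::comm_ring_1"
  shows "f \<in> module.span (*) {m, s} \<longleftrightarrow> (\<exists>a b. f = a * m + b * s)"
  by (simp add: ideal_span_insert[of m "{s}"] ideal_span_singleton image_iff diff_eq_eq add.commute)

text \<open>Since \<open>s\<close> absorbs the modulus, the ideal is principal, and membership in a
  code becomes plain divisibility.\<close>

lemma span_pair_dvd:
  fixes f m s :: "'a::comm_ring_1"
  assumes "s dvd m"
  shows "f \<in> module.span (*) {m, s} \<longleftrightarrow> s dvd f"
proof
  assume "f \<in> module.span (*) {m, s}"
  then show "s dvd f" using assms by (auto simp: mem_span_pair)
next
  assume "s dvd f"
  then obtain k where "f = s * k" by (rule dvdE)
  then have "f = 0 * m + k * s" by (simp add: mult.commute)
  then show "f \<in> module.span (*) {m, s}" unfolding mem_span_pair by blast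
qed

lemma code_gen_dvd:
  "s dvd xn_minus l n \<Longrightarrow> code_gen l n {s} = {c \<in> carrier_vec n. s dvd poly_of_code c}"
  by (simp add: code_gen_def span_pair_dvd)

lemma zero_in_code_gen: "0\<^sub>v n \<in> code_gen l n S"
  by (simp add: code_gen_def poly_of_code_zero ideal_span_zero)

lemma code_gen_subset: "code_gen l n S \<subseteq> carrier_vec n"
  by (auto simp: code_gen_def)

text \<open>Kept over an arbitrary commutative ring because it is applied to codes over R directly,
  not coordinatewise.\<close>

lemma constacyclic_code_gen:
  assumes "n \<ge> 1"
  shows "constacyclic l n (code_gen l n S)"
proof -
  let ?I = "module.span (*) (insert (xn_minus l n) S)"
  have smult: "smult a f \<in> ?I" if "f \<in> ?I" for a f
    using ideal_span_scale[OF that, of "[:a:]"] by simp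
  have shift: "pCons 0 f \<in> ?I" if "f \<in> ?I" for f
    using ideal_span_scale[OF that, of "[:0, 1:]"] by simp
  have base: "xn_minus l n \<in> ?I" by (simp add: ideal_span_base)
  have "linear_code n (code_gen l n S)"
    by (auto simp: linear_code_def zero_in_code_gen code_gen_subset)
      (auto simp: code_gen_def poly_of_code_add poly_of_code_smult ideal_span_add smult)
  moreover have "constashift l c \<in> code_gen l n S" if "c \<in> code_gen l n S" for c
  proof -
    have c: "c \<in> carrier_vec n" "poly_of_code c \<in> ?I" using that by (auto simp: code_gen_def)
    have "poly_of_code (constashift l c) \<in> ?I"
      unfolding poly_of_code_constashift[OF c(1) assms]
      by (intro ideal_span_diff shift smult base c(2))
    moreover have "constashift l c \<in> carrier_vec n"
      using c(1) by (rule constashift_carrier)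
    ultimately show ?thesis by (simp add: code_gen_def)
  qed
  ultimately show ?thesis by (simp add: constacyclic_def)
qed

section \<open>Constacyclic codes over a field\<close>

lemma mod_xn_minus_coeff:
  fixes f :: "'a::field poly"
  assumes "n \<ge> 1" "i \<ge> n"
  shows "coeff (f mod xn_minus l n) i = 0"
proof (rule coeff_eq_0)
  show "degree (f mod xn_minus l n) < i"
    using degree_mod_less[OF xn_minus_nonzero[OF assms(1), of l], of f] assms
    by (auto simp: degree_xn_minus)
qed

lemma mod_xn_minus_poly_of_code:
  fixes c :: "'a::field vec"
  assumes "c \<in> carrier_vec n" "n \<ge> 1"
  shows "poly_of_code c mod xn_minus l n = poly_of_code c"
  using assms degree_poly_of_code_less[of c] by (intro mod_poly_less) (auto simp: degree_xn_minus)

lemma card_carrier_vec: "card (carrier_vec n :: 'a::finite vec set) = CARD('a) ^ n"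
proof -
  have "bij_betw list_of_vec (carrier_vec n :: 'a vec set) {xs. set xs \<subseteq> UNIV \<and> length xs = n}"
    by (rule bij_betw_byWitness[where f' = vec_of_list]) 
      (auto simp: vec_list list_vec intro: carrier_vecI)
  then show ?thesis using card_lists_length_eq[of "UNIV :: 'a set" n] by (simp add: bij_betw_same_card)
qed

text \<open>Multiplication by \<open>g\<close> carries messages of length n - deg g bijectively to
  codewords: the quotient of a codeword by \<open>g\<close> has no coefficient beyond that
  length.\<close>

lemma card_code_gen:
  fixes g :: "'a::{field,finite} poly"
  assumes n: "n \<ge> 1" and g: "g dvd xn_minus l n"
  shows "card (code_gen l n {g}) = CARD('a) ^ (n - degree g)"
proof -
  have g0: "g \<noteq> 0" using g xn_minus_nonzero[OF n, of l] by auto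
  define k where "k = n - degree g"
  have gn: "degree g \<le> n"
    using dvd_imp_degree_le[OF g xn_minus_nonzero[OF n]] by (simp add: degree_xn_minus[OF n])
  let ?f = "\<lambda>a. vec n (coeff (g * poly_of_code a))"
  have deg: "coeff (g * poly_of_code a) i = 0" if a: "a \<in> carrier_vec k" and "i \<ge> n" for a i
  \<comment> \<open>The empty message has the zero polynomial, whose degree 0 is not below k = 0, so
    the strict degree bound of the other case fails here.\<close>
  proof (cases "k = 0")
    case True
    then have "poly_of_code a = 0" using a by (auto simp: poly_of_code_def)
    then show ?thesis by simp
  next
    case False
    then have "degree (poly_of_code a) < k" using degree_poly_of_code_less[of a] a by auto
    then show ?thesis
      using degree_mult_le[of g "poly_of_code a"] that gn k_def by (intro coeff_eq_0) linarith
  qed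
  have "bij_betw ?f (carrier_vec k) (code_gen l n {g})"
  proof (rule bij_betw_imageI)
    show "inj_on ?f (carrier_vec k)"
    proof (rule inj_onI)
      fix a b :: "'a vec" assume ab: "a \<in> carrier_vec k" "b \<in> carrier_vec k" "?f a = ?f b"
      then have "g * poly_of_code a = g * poly_of_code b"
        using poly_of_code_vec_coeff[OF deg] by metis
      then show "a = b" using g0 ab by (auto intro: poly_of_code_inject)
    qed
    show "?f ` carrier_vec k = code_gen l n {g}"
    proof safe
      fix a :: "'a vec" assume "a \<in> carrier_vec k"
      then show "?f a \<in> code_gen l n {g}"
        by (simp add: code_gen_dvd[OF g] poly_of_code_vec_coeff[OF deg])
    next
      fix c assume c: "c \<in> code_gen l n {g}"
      then obtain q where q: "poly_of_code c = g * q" and cn: "c \<in> carrier_vec n"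
        by (auto simp: code_gen_dvd[OF g] elim!: dvdE)
      have "coeff q i = 0" if "i \<ge> k" for i
      proof (cases "q = 0")
        case False
        then have "degree g + degree q < n"
          using degree_poly_of_code_less[of c] cn n degree_mult_eq[OF g0 False] q by auto
        then show ?thesis using that by (intro coeff_eq_0) (simp add: k_def)
      qed simp
      then have "c = ?f (vec k (coeff q))"
        using q cn by (metis poly_of_code_vec_coeff vec_coeff_poly_of_code)
      then show "c \<in> ?f ` carrier_vec k" by auto
    qed
  qed
  then show ?thesis using bij_betw_same_card card_carrier_vec k_def by metis
qed

lemma code_gen_subset_imp_dvd:
  fixes g q :: "'a::field poly"
  assumes n: "n \<ge> 1" and g: "g dvd xn_minus l n" and q: "q dvd xn_minus l n"
    and sub: "code_gen l n {q} \<subseteq> code_gen l n {g}"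
  shows "g dvd q"
proof -
  \<comment> \<open>\<open>q\<close> can have degree n, as for the zero code, and is then no word of
    length n. Its remainder is one, and \<open>g\<close> divides the remainder iff it divides
    \<open>q\<close>.\<close>
  let ?v = "vec n (coeff (q mod xn_minus l n))"
  have v: "poly_of_code ?v = q mod xn_minus l n"
    by (rule poly_of_code_vec_coeff) (rule mod_xn_minus_coeff[OF n])
  have "?v \<in> code_gen l n {q}" using q by (simp add: code_gen_dvd v dvd_mod)
  then have "?v \<in> code_gen l n {g}" using sub by blast
  then have "g dvd q mod xn_minus l n" by (simp add: code_gen_dvd[OF g] v)
  then show ?thesis using g by (simp add: dvd_mod_iff)
qed

lemma generator_unique:
  fixes g q :: "'a::field poly"
  assumes "n \<ge> 1" "g dvd xn_minus l n" "q dvd xn_minus l n" "monic g" "monic q"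
    and "code_gen l n {q} = code_gen l n {g}"
  shows "g = q"
  using assms code_gen_subset_imp_dvd[of n g l q] code_gen_subset_imp_dvd[of n q l g]
  by (auto intro: poly_dvd_antisym)

text \<open>The polynomials whose remainder is a codeword form an ideal of the full polynomial ring.
  It contains the modulus, so it has monic elements even for the zero code, and one of least degree
  divides all others.\<close>

lemma constacyclic_generator:
  fixes D :: "'a::field vec set"
  assumes n: "n \<ge> 1" and D: "constacyclic l n D"
  obtains g where "generator_poly l n D g"
proof -
  let ?m = "xn_minus l n"
  define I where "I = {f. vec n (coeff (f mod ?m)) \<in> D}"
  have lin: "D \<subseteq> carrier_vec n" "0\<^sub>v n \<in> D" "\<And>v w. v \<in> D \<Longrightarrow> w \<in> D \<Longrightarrow> v + w \<in> D"
    "\<And>a v. v \<in> D \<Longrightarrow> a \<cdot>\<^sub>v v \<in> D" "\<And>v. v \<in> D \<Longrightarrow> constashift l v \<in> D"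
    using D by (auto simp: constacyclic_def linear_code_def)
  have add: "f + q \<in> I" if "f \<in> I" "q \<in> I" for f q
  proof -
    have "vec n (coeff ((f + q) mod ?m)) = vec n (coeff (f mod ?m)) + vec n (coeff (q mod ?m))"
      by (intro eq_vecI) (auto simp: poly_mod_add_left)
    then show ?thesis using that lin by (simp add: I_def)
  qed
  have scale: "smult a f \<in> I" if "f \<in> I" for a f
  proof -
    have "vec n (coeff (smult a f mod ?m)) = a \<cdot>\<^sub>v vec n (coeff (f mod ?m))"
      by (intro eq_vecI) (auto simp: mod_smult_left)
    then show ?thesis using that lin by (simp add: I_def)
  qed
  have zero: "0 \<in> I"
  proof -
    have "vec n (coeff (0 mod ?m)) = 0\<^sub>v n" by (intro eq_vecI) auto
    then show ?thesis using lin by (simp add: I_def)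
  qed
  have shift: "pCons 0 f \<in> I" if "f \<in> I" for f
  proof -
    let ?c = "vec n (coeff (f mod ?m))"
    have c: "poly_of_code ?c = f mod ?m"
      by (rule poly_of_code_vec_coeff) (rule mod_xn_minus_coeff[OF n])
    have s: "constashift l ?c \<in> carrier_vec n" by (intro constashift_carrier vec_carrier)
    have "pCons 0 f mod ?m = ([:0, 1:] * (f mod ?m)) mod ?m"
      by (simp only: mod_mult_right_eq) simp
    also have "\<dots> = (pCons 0 (f mod ?m) - smult (?c $ (n - 1)) ?m) mod ?m"
      by (simp add: poly_mod_diff_left mod_smult_left)
    also have "\<dots> = poly_of_code (constashift l ?c) mod ?m"
      using n by (simp add: poly_of_code_constashift c)
    also have "\<dots> = poly_of_code (constashift l ?c)"
      using s n by (rule mod_xn_minus_poly_of_code)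
    finally have "vec n (coeff (pCons 0 f mod ?m)) = constashift l ?c"
      using s by (simp add: vec_coeff_poly_of_code)
    then show ?thesis using that lin by (simp add: I_def)
  qed
  have mult: "q * f \<in> I" if "f \<in> I" for f q
    by (induction q) (use that in \<open>auto simp: zero add scale shift\<close>)
  have m: "?m \<in> I" using zero by (simp add: I_def)
  obtain g where g: "monic g" "g \<in> I" and least: "\<And>f. monic f \<Longrightarrow> f \<in> I \<Longrightarrow> degree g \<le> degree f"
    using ex_has_least_nat[of "\<lambda>f. monic f \<and> f \<in> I" ?m degree] m monic_xn_minus[OF n, of l] by blast
  have dvd: "g dvd f" if f: "f \<in> I" for f
  proof (rule ccontr)
    let ?r = "f mod g"
    assume "\<not> g dvd f"
    then have r: "?r \<noteq> 0" "degree ?r < degree g"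
      using g(1) by (auto simp: mod_eq_0_iff_dvd intro!: degree_mod_less_degree)
    have "?r = f + (- (f div g)) * g"
      by (simp add: minus_div_mult_eq_mod[symmetric])
    then have "?r \<in> I" using add[OF f mult[OF g(2)]] by metis
    then have "smult (inverse (lead_coeff ?r)) ?r \<in> I" by (rule scale)
    then show False using least[of "smult (inverse (lead_coeff ?r)) ?r"] r by auto
  qed
  have iff: "f \<in> I \<longleftrightarrow> g dvd f" for f
    using dvd mult[OF g(2)] by (auto elim!: dvdE simp: mult.commute)
  have gm: "g dvd ?m" using dvd m by blast
  have "D = code_gen l n {g}"
  proof (intro Set.set_eqI)
    fix c
    show "c \<in> D \<longleftrightarrow> c \<in> code_gen l n {g}"
    proof (cases "c \<in> carrier_vec n")
      case True
      then have "c \<in> D \<longleftrightarrow> poly_of_code c \<in> I"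
        using n by (simp add: I_def mod_xn_minus_poly_of_code vec_coeff_poly_of_code)
      then show ?thesis using True by (simp add: iff code_gen_dvd[OF gm])
    qed (use lin(1) code_gen_subset in blast)
  qed
  then show ?thesis using that g(1) gm by (simp add: generator_poly_def)
qed

text \<open>Multiplying a Bezout identity for \<open>f\<close> and \<open>h\<close> by
  \<open>g\<close> recovers \<open>g\<close> from \<open>g * f\<close> and the modulus. As
  \<open>g * f\<close> need not divide the modulus, the argument runs on ideal membership instead of
  divisibility.\<close>

lemma code_gen_unit_multiple:
  fixes g h f :: "'a::field_gcd poly"
  assumes gh: "g * h = xn_minus l n" and "gcd f h = 1"
  shows "code_gen l n {g * f} = code_gen l n {g}"
proof -
  let ?m = "xn_minus l n"
  obtain r s where rs: "r * f + s * h = 1"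
    using assms(2) bezout_coefficients_fst_snd by metis
  have g: "g = s * ?m + r * (g * f)"
  proof -
    have "s * ?m + r * (g * f) = g * (r * f + s * h)"
      unfolding gh[symmetric] by (simp only: algebra_simps)
    then show ?thesis unfolding rs by simp
  qed
  have "(q \<in> module.span (*) {?m, g * f}) \<longleftrightarrow> (q \<in> module.span (*) {?m, g})" for q
  proof
    assume "q \<in> module.span (*) {?m, g * f}"
    then obtain a b where q: "q = a * ?m + b * (g * f)" unfolding mem_span_pair by blast
    have "q = a * ?m + (b * f) * g" unfolding q by (simp only: mult_ac)
    then show "q \<in> module.span (*) {?m, g}" unfolding mem_span_pair by blast
  next
    assume "q \<in> module.span (*) {?m, g}"
    then obtain a b where q: "q = a * ?m + b * g" unfolding mem_span_pair by blast
    have "q = a * ?m + b * (s * ?m + r * (g * f))" using q g by metis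
    also have "\<dots> = (a + b * s) * ?m + (b * r) * (g * f)" by (simp only: algebra_simps)
    finally have "q = (a + b * s) * ?m + (b * r) * (g * f)" .
    then show "q \<in> module.span (*) {?m, g * f}" unfolding mem_span_pair by blast
  qed
  then show ?thesis by (simp add: code_gen_def)
qed

section \<open>Duality over a field\<close>

text \<open>A nonzero k must have degree below n - 1. Then x^n k starts at degree n while l k ends
  before n - 1, which leaves a gap exactly at n - 1.\<close>

lemma coeff_xn_minus_mult_middle:
  fixes k :: "'a::field poly"
  assumes n: "n \<ge> 1" and "degree (xn_minus l n * k) < 2 * n - 1"
  shows "coeff (xn_minus l n * k) (n - 1) = 0"
proof (cases "k = 0")
  case False
  then have "n + degree k < 2 * n - 1"
    using assms degree_mult_eq[OF xn_minus_nonzero[OF n, of l]] by (simp add: degree_xn_minus[OF n])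
  then show ?thesis using n by (simp add: coeff_xn_minus_mult coeff_eq_0)
qed simp

abbreviation vec_rev :: "'a vec \<Rightarrow> 'a vec" where
  "vec_rev v \<equiv> vec (dim_vec v) (\<lambda>i. v $ (dim_vec v - 1 - i))"

text \<open>\<open>reflect_poly\<close> reverses only up to the degree, \<open>vec_rev\<close> over
  the full length; the power of x accounts for the trailing zeros of \<open>v\<close>.\<close>

lemma poly_of_code_vec_rev:
  fixes v :: "'a::comm_ring_1 vec"
  assumes v: "v \<in> carrier_vec n" and n: "n \<ge> 1"
  shows "poly_of_code (vec_rev v) =
    monom 1 (n - 1 - degree (poly_of_code v)) * reflect_poly (poly_of_code v)"
proof (rule poly_eqI)
  let ?V = "poly_of_code v"
  have d: "degree ?V < n" using degree_poly_of_code_less[of v] v n by auto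
  fix i
  show "coeff (poly_of_code (vec_rev v)) i = coeff (monom 1 (n - 1 - degree ?V) * reflect_poly ?V) i"
  proof (cases "i < n")
    case True
    have "coeff (poly_of_code (vec_rev v)) i = coeff ?V (n - 1 - i)"
      using v True by (auto simp: coeff_poly_of_code)
    moreover have "coeff (monom 1 (n - 1 - degree ?V) * reflect_poly ?V) i = coeff ?V (n - 1 - i)"
      using True d by (auto simp: coeff_monom_mult coeff_reflect_poly intro!: coeff_eq_0 arg_cong[of _ _ "coeff ?V"])
    ultimately show ?thesis by simp
  next
    case False
    then show ?thesis using v d by (auto simp: coeff_poly_of_code coeff_monom_mult coeff_reflect_poly)
  qed
qed

text \<open>In the convolution at degree n - 1 the letter of \<open>c\<close> at i meets the
  reversed word at n - 1 - i, which is the letter of \<open>v\<close> at i.\<close>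

lemma scalar_prod_eq_coeff:
  fixes v c :: "'a::comm_ring_1 vec"
  assumes "v \<in> carrier_vec n" "c \<in> carrier_vec n" "n \<ge> 1"
  shows "v \<bullet> c = coeff (poly_of_code (vec_rev v) * poly_of_code c) (n - 1)"
proof -
  have "coeff (poly_of_code (vec_rev v) * poly_of_code c) (n - 1) =
      (\<Sum>i<n. v $ (n - 1 - i) * c $ (n - 1 - i))"
    using assms by (auto simp: coeff_mult coeff_poly_of_code intro!: sum.cong)
  also have "\<dots> = (\<Sum>i<n. v $ i * c $ i)"
    using sum.nat_diff_reindex[of "\<lambda>i. v $ i * c $ i" n] by simp
  finally show ?thesis using assms by (simp add: scalar_prod_def lessThan_atLeast0)
qed

lemma reflect_xn_minus:
  fixes l :: "'a::field"
  assumes "l * l = 1" "n \<ge> 1"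
  shows "reflect_poly (xn_minus l n) = smult (- l) (xn_minus l n)"
  using assms by (intro poly_eqI) (auto simp: coeff_reflect_poly degree_xn_minus coeff_xn_minus)

lemma reflect_poly_dvd_xn_minus:
  fixes h :: "'a::field poly"
  assumes "l * l = 1" "n \<ge> 1" "h dvd xn_minus l n"
  shows "reflect_poly h dvd xn_minus l n"
proof -
  have "reflect_poly h dvd reflect_poly (xn_minus l n)"
    using assms(3) by (auto simp: reflect_poly_mult)
  moreover have "l \<noteq> 0" using assms(1) by auto
  ultimately show ?thesis using reflect_xn_minus[OF assms(1,2)] by (simp add: dvd_smult_iff)
qed

text \<open>A nonzero constant term is what makes \<open>reflect_poly\<close> undo itself and keep
  the degree; the dual code uses the former, its cardinality the latter.\<close>

lemma dvd_xn_minus_coeff_0: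
  fixes h :: "'a::field poly"
  assumes "l \<noteq> 0" "n \<ge> 1" "h dvd xn_minus l n"
  shows "coeff h 0 \<noteq> 0"
proof
  assume "coeff h 0 = 0"
  then have "coeff (xn_minus l n) 0 = 0" using assms(3) by (auto simp: coeff_mult)
  then show False using assms by (simp add: coeff_xn_minus)
qed

text \<open>Writing \<open>W\<close> for the reversal of \<open>v\<close>, the inner product \<open>v \<bullet> c\<close> is the coefficient of
  \<open>x^(n-1)\<close> in \<open>W c\<close> modulo \<open>x^n - l\<close>. As multiplication by powers of \<open>x\<close> makes this
  functional nondegenerate, \<open>v\<close> is orthogonal to the ideal of \<open>g\<close> iff \<open>x^n - l\<close> divides \<open>W g\<close>,
  i.e. iff \<open>h\<close> divides \<open>W\<close>.\<close>

lemma orthogonal_iff_dvd_rev: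
  fixes g h :: "'a::field poly"
  assumes n: "n \<ge> 1" and gh: "g * h = xn_minus l n" and v: "v \<in> carrier_vec n"
  shows "(\<forall>c\<in>code_gen l n {g}. v \<bullet> c = 0) \<longleftrightarrow> h dvd poly_of_code (vec_rev v)"
proof -
  let ?m = "xn_minus l n" and ?W = "poly_of_code (vec_rev v)"
  have gm: "g dvd ?m" by (simp add: gh[symmetric])
  have g0: "g \<noteq> 0" using gh xn_minus_nonzero[OF n, of l] by auto
  have degW: "degree ?W \<le> n - 1"
    using degree_poly_of_code_less[of "vec_rev v"] v n by auto
  have degWc: "degree (?W * poly_of_code c) \<le> 2 * n - 2" if "c \<in> carrier_vec n" for c
    using degree_mult_le[of ?W "poly_of_code c"] degW degree_poly_of_code_less[of c] that n by auto
  show ?thesis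
  proof
    assume h: "h dvd ?W"
    show "\<forall>c\<in>code_gen l n {g}. v \<bullet> c = 0"
    proof
      fix c assume "c \<in> code_gen l n {g}"
      then have c: "c \<in> carrier_vec n" "g dvd poly_of_code c" by (auto simp: code_gen_dvd[OF gm])
      have "?m dvd ?W * poly_of_code c"
        using mult_dvd_mono[OF c(2) h] by (simp add: gh mult.commute)
      then obtain k where k: "?W * poly_of_code c = ?m * k" by (rule dvdE)
      then have "coeff (?m * k) (n - 1) = 0"
        using degWc[OF c(1)] n by (intro coeff_xn_minus_mult_middle) auto
      then show "v \<bullet> c = 0" using scalar_prod_eq_coeff[OF v c(1) n] k by simp
    qed
  next
    assume orth: "\<forall>c\<in>code_gen l n {g}. v \<bullet> c = 0"
    define f where "f = (?W * g) mod ?m"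
    have "f = 0"
    proof (rule ccontr)
      assume f: "f \<noteq> 0"
      then have d: "degree f < n"
        using degree_mod_less'[OF xn_minus_nonzero[OF n], of "?W * g" l]
        by (simp add: f_def degree_xn_minus[OF n])
      \<comment> \<open>This power of x moves the leading coefficient of \<open>f\<close> to degree
        n - 1, the one place that an inner product sees.\<close>
      let ?a = "monom 1 (n - 1 - degree f) :: 'a poly"
      let ?c = "vec n (coeff ((g * ?a) mod ?m))"
      have c: "poly_of_code ?c = (g * ?a) mod ?m"
        by (rule poly_of_code_vec_coeff) (rule mod_xn_minus_coeff[OF n])
      have "?c \<in> code_gen l n {g}"
        unfolding code_gen_dvd[OF gm] mem_Collect_eq c using gm by (simp add: dvd_mod)
      then have "coeff (?W * poly_of_code ?c) (n - 1) = 0"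
        using orth scalar_prod_eq_coeff[OF v _ n, of ?c] by auto
      moreover have "(?W * poly_of_code ?c) mod ?m = (?W * g * ?a) mod ?m"
        unfolding c mult.assoc by (rule mod_mult_right_eq)
      then have "(?W * poly_of_code ?c) mod ?m = (f * ?a) mod ?m"
        using mod_mult_left_eq[of "?W * g" ?m ?a] unfolding f_def[symmetric] by simp
      then have "?m dvd ?W * poly_of_code ?c - f * ?a"
        by (simp only: mod_eq_dvd_iff)
      then obtain k where k: "?W * poly_of_code ?c - f * ?a = ?m * k" by (rule dvdE)
      have "degree (f * ?a) \<le> n - 1"
        using d f by (simp add: degree_mult_eq degree_monom_eq)
      then have "degree (?W * poly_of_code ?c - f * ?a) \<le> 2 * n - 2"
        using degWc[of ?c] n by (intro degree_diff_le) auto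
      then have "coeff (?m * k) (n - 1) = 0"
        unfolding k using n by (intro coeff_xn_minus_mult_middle) auto
      moreover have "coeff (f * ?a) (n - 1) = lead_coeff f"
        using d by (simp add: mult.commute[of f] coeff_monom_mult)
      ultimately have "lead_coeff f = 0" using k by (metis coeff_diff diff_0 neg_equal_0_iff_equal)
      then show False using f by simp
    qed
    then have "g * h dvd g * ?W" by (simp add: f_def gh mult.commute mod_eq_0_iff_dvd)
    then show "h dvd ?W" using g0 by simp
  qed
qed

lemma dual_code_gen:
  fixes g h :: "'a::field poly"
  assumes n: "n \<ge> 1" and gh: "g * h = xn_minus l n" and l: "l * l = 1"
  shows "dual_code n (code_gen l n {g}) = code_gen l n {reflect_poly h}"
proof -
  have l0: "l \<noteq> 0" using l by auto
  have hm: "h dvd xn_minus l n" by (simp add: gh[symmetric])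
  have rm: "reflect_poly h dvd xn_minus l n" using l n hm by (rule reflect_poly_dvd_xn_minus)
  have rr: "reflect_poly (reflect_poly h) = h" using dvd_xn_minus_coeff_0[OF l0 n hm] by simp
  \<comment> \<open>One implication serves both directions below, since reversing words and
    reflecting \<open>h\<close> are involutions.\<close>
  have reflect_dvd: "reflect_poly q dvd poly_of_code (vec_rev v)"
    if "v \<in> carrier_vec n" "q dvd poly_of_code v" for v and q :: "'a poly"
  proof -
    have "reflect_poly q dvd reflect_poly (poly_of_code v)"
      using that(2) by (auto simp: reflect_poly_mult)
    then show ?thesis using poly_of_code_vec_rev[OF that(1) n] by simp
  qed
  have "h dvd poly_of_code (vec_rev v) \<longleftrightarrow> reflect_poly h dvd poly_of_code v"
    if v: "v \<in> carrier_vec n" for v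
  proof
    assume "h dvd poly_of_code (vec_rev v)"
    moreover have "vec_rev (vec_rev v) = v" by (intro eq_vecI) auto
    ultimately show "reflect_poly h dvd poly_of_code v"
      using reflect_dvd[of "vec_rev v" h] v by simp
  next
    assume "reflect_poly h dvd poly_of_code v"
    then show "h dvd poly_of_code (vec_rev v)" using reflect_dvd[OF v] rr by metis
  qed
  then show ?thesis
    unfolding dual_code_def code_gen_dvd[OF rm]
    using orthogonal_iff_dvd_rev[OF n gh] by blast
qed

section \<open>Counting monic divisors\<close>

text \<open>A repeated factor divides the derivative n x^(n-1), hence x^n as n is invertible, hence
  also the nonzero constant l.\<close>

lemma squarefree_xn_minus:
  fixes l :: "'a::field"
  assumes n: "n \<ge> 1" and l: "l \<noteq> 0" and "of_nat n \<noteq> (0 :: 'a)"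
  shows "squarefree (xn_minus l n)"
proof (rule squarefreeI)
  fix f :: "'a poly" assume f: "f ^ 2 dvd xn_minus l n"
  then obtain k where "xn_minus l n = f ^ 2 * k" by (rule dvdE)
  then have k: "xn_minus l n = f * (f * k)" by (simp only: power2_eq_square mult.assoc)
  have "pderiv (xn_minus l n) = monom (of_nat n) (n - 1)"
    by (simp add: xn_minus_def pderiv_diff pderiv_monom pderiv_pCons)
  moreover have "f dvd pderiv (xn_minus l n)"
    unfolding k by (simp add: pderiv_mult)
  ultimately have "f dvd smult (inverse (of_nat n)) (monom (of_nat n) (n - 1))"
    by (simp add: dvd_smult)
  then have "f dvd monom 1 (n - 1)" using assms by (simp add: smult_monom)
  then have "f dvd monom 1 1 * monom 1 (n - 1)" by (rule dvd_mult)
  then have "f dvd monom 1 n" using n by (simp add: mult_monom)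
  moreover have "f dvd xn_minus l n" by (simp add: k)
  ultimately have "f dvd monom 1 n - xn_minus l n" by (rule dvd_diff)
  then have "f dvd [:l:]" by (simp add: xn_minus_def)
  then show "f dvd 1" using l by (metis dvd_trans is_unit_triv)
qed

text \<open>All multiplicities are at most one, so a monic divisor is the product of the set of its
  monic irreducible factors, and every such set occurs.\<close>

lemma card_monic_divisors_squarefree:
  fixes m :: "'a::field_gcd poly"
  assumes sf: "squarefree m"
  shows "card {q. monic q \<and> q dvd m} = 2 ^ card {q. monic q \<and> irreducible q \<and> q dvd m}"
proof -
  have m0: "m \<noteq> 0" using sf by auto
  \<comment> \<open>Monic polynomials are the canonical representatives up to units, so that
    \<open>prime_factors\<close> lists exactly the monic irreducible divisors.\<close>
  have normal: "monic q \<longleftrightarrow> q \<noteq> 0 \<and> normalize q = q" for q :: "'a poly"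
  proof
    assume q: "q \<noteq> 0 \<and> normalize q = q"
    then have "unit_factor q = 1" by (metis unit_factor_normalize)
    then have "[:lead_coeff q:] = 1"
      using q by (simp add: unit_factor_poly_def is_unit_unit_factor dvd_field_iff)
    then show "monic q" by (simp add: one_pCons)
  qed (auto simp: normalize_monic)
  have P: "{q. monic q \<and> irreducible q \<and> q dvd m} = prime_factors m"
    using m0 by (auto simp: prime_factors_dvd prime_def normal prime_elem_iff_irreducible)
  have sub: "prime p" if "A \<subseteq> prime_factors m" "p \<in> A" for A p using that by auto
  have fin: "finite A" if "A \<subseteq> prime_factors m" for A
    using that finite_subset by blast
  have pf: "prime_factorization (\<Prod>A) = mset_set A" if A: "A \<subseteq> prime_factors m" for A
  proof -
    have "prime_factorization (prod_mset (mset_set A)) = mset_set A"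
      using A fin[OF A] by (intro prime_factorization_prod_mset_primes) auto
    then show ?thesis by (simp add: prod_unfold_prod_mset)
  qed
  have sq: "prime_factorization q = mset_set (prime_factors q)" if "q dvd m" for q
  proof (rule multiset_eqI)
    fix p
    have q0: "q \<noteq> 0" using that m0 by auto
    have "multiplicity p q = 1" if "p \<in> prime_factors q"
      using squarefree_factorial_semiring'[OF q0] squarefree_mono[OF \<open>q dvd m\<close> sf] that by auto
    moreover have "count (prime_factorization q) p = 0" if "p \<notin> prime_factors q"
      using that by (simp add: not_in_iff)
    ultimately show "count (prime_factorization q) p = count (mset_set (prime_factors q)) p"
      by (cases "p \<in> prime_factors q")
        (simp_all add: count_prime_factorization_prime in_prime_factors_imp_prime)
  qed
  have bij: "bij_betw Prod (Pow (prime_factors m)) {q. monic q \<and> q dvd m}"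
  proof (rule bij_betw_imageI)
    show "inj_on Prod (Pow (prime_factors m))"
      by (rule inj_onI) (metis PowD pf fin finite_set_mset_mset_set)
    show "Prod ` Pow (prime_factors m) = {q. monic q \<and> q dvd m}"
    proof safe
      fix A assume A: "A \<subseteq> prime_factors m"
      have nz: "\<Prod>A \<noteq> 0" using A fin[OF A] by auto
      have "\<Prod>A = prod_mset (prime_factorization (\<Prod>A))"
        using pf[OF A] by (simp add: prod_unfold_prod_mset)
      then have "normalize (\<Prod>A) = \<Prod>A"
        using prod_mset_prime_factorization[OF nz] by simp
      then show "monic (\<Prod>A)" using nz normal by blast
      have "mset_set A \<subseteq># mset_set (prime_factors m)"
        using A by (intro subset_imp_msubset_mset_set) auto
      then have "prime_factorization (\<Prod>A) \<subseteq># prime_factorization m"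
        using pf[OF A] sq[of m] by simp
      then show "\<Prod>A dvd m"
        using prime_factorization_subset_iff_dvd[OF nz m0] by blast
    next
      fix q assume q: "monic q" "q dvd m"
      then have q0: "q \<noteq> 0" by auto
      have "q = prod_mset (prime_factorization q)"
        using prod_mset_prime_factorization[OF q0] q(1) normal by metis
      also have "\<dots> = prod_mset (mset_set (prime_factors q))"
        by (rule arg_cong[OF sq[OF q(2)]])
      also have "\<dots> = \<Prod>(prime_factors q)" by (simp add: prod_unfold_prod_mset)
      finally have "q = \<Prod>(prime_factors q)" .
      moreover have "prime_factors q \<subseteq> prime_factors m"
        using q(2) m0 by (rule dvd_prime_factors[rotated])
      ultimately show "q \<in> Prod ` Pow (prime_factors m)" by blast
    qed
  qed
  show "card {q. monic q \<and> q dvd m} = 2 ^ card {q. monic q \<and> irreducible q \<and> q dvd m}"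
    unfolding P bij_betw_same_card[OF bij, symmetric] by (simp add: card_Pow)
qed

section \<open>Splitting \<open>R\<close> into four copies of the field\<close>

locale cube_root =
  fixes \<xi> :: "'a::field"
  assumes primitive: "primitive_root_of_unity 3 \<xi>"
begin

lemma cube: "\<xi> ^ 3 = 1" and ne_1: "\<xi> \<noteq> 1"
  using primitive by (auto simp: primitive_root_of_unity_def dest: spec[of _ 1])

lemma xi_sq: "\<xi> ^ 2 = - 1 - \<xi>"
proof -
  have "(\<xi> - 1) * (\<xi> ^ 2 + \<xi> + 1) = \<xi> ^ 3 - 1"
    by (simp add: power2_eq_square power3_eq_cube algebra_simps)
  then have "\<xi> ^ 2 + \<xi> + 1 = 0" using cube ne_1 by simp
  then show ?thesis by (simp add: algebra_simps eq_neg_iff_add_eq_0)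
qed

text \<open>The second identity serves the right-nested products that \<open>algebra_simps\<close>
  leaves.\<close>

lemma xi_powers: "\<xi> * \<xi> = - 1 - \<xi>" "\<xi> * (\<xi> * z) = (- 1 - \<xi>) * z" "\<xi> ^ 4 = \<xi>" "\<xi> ^ 6 = 1"
proof -
  show "\<xi> * \<xi> = - 1 - \<xi>" using xi_sq by (simp add: power2_eq_square)
  then show "\<xi> * (\<xi> * z) = (- 1 - \<xi>) * z" by (metis mult.assoc)
  show "\<xi> ^ 4 = \<xi>" using power_add[of \<xi> 3 1] cube by simp
  show "\<xi> ^ 6 = 1" using power_mult[of \<xi> 3 2] cube by simp
qed

text \<open>In characteristic 3 one has x^2 + x + 1 = (x - 1)^2, so 1 would be the only cube root of
  unity. Hence \<open>inverse 3\<close> in \<open>eta\<close> is a genuine inverse.\<close>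

lemma three_nonzero: "(3 :: 'a) \<noteq> 0"
proof
  assume "(3 :: 'a) = 0"
  moreover have "(\<xi> - 1) ^ 2 = \<xi> ^ 2 + \<xi> + 1 - 3 * \<xi>"
    by (simp add: power2_eq_square algebra_simps)
  ultimately have "(\<xi> - 1) ^ 2 = 0" by (simp add: xi_sq)
  then show False using ne_1 by simp
qed

text \<open>The homomorphism attached to \<open>\<eta>\<^sub>j\<close> evaluates \<open>u\<close> at the root of \<open>X^4 - X\<close> at which
  \<open>\<eta>\<^sub>j\<close> takes the value 1; for \<open>\<eta>\<^sub>3\<close> this is \<open>\<xi>^2\<close>, not \<open>\<xi>\<close>.\<close>

definition root_pt :: "nat \<Rightarrow> 'a" where
  "root_pt j = (if j = 1 then 0 else if j = 2 then 1 else if j = 3 then \<xi> ^ 2 else \<xi>)"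

definition proj :: "nat \<Rightarrow> 'a ur \<Rightarrow> 'a" where
  "proj j x = ur0 x + ur1 x * root_pt j + ur2 x * root_pt j ^ 2 + ur3 x * root_pt j ^ 3"

text \<open>The relation u^4 = u holds at the chosen points, which makes evaluation there
  multiplicative.\<close>

lemma root_pt_power4: "root_pt j ^ 4 = root_pt j"
proof -
  have "\<xi> ^ 4 = \<xi> ^ 3 * \<xi>" "(\<xi> ^ 2) ^ 4 = (\<xi> ^ 3) ^ 2 * \<xi> ^ 2"
    by (simp_all add: power_mult[symmetric] power_add[symmetric] power_Suc2[symmetric]
        del: power_Suc power_Suc2)
  then show ?thesis by (simp add: root_pt_def cube)
qed

lemma proj_0: "proj j 0 = 0"
  and proj_1: "proj j 1 = 1"
  and proj_add: "proj j (x + y) = proj j x + proj j y"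
  by (simp_all add: proj_def zero_ur_def one_ur_def plus_ur_def algebra_simps)

lemma proj_mult: "proj j (x * y) = proj j x * proj j y"
proof -
  let ?w = "root_pt j"
  have w: "?w * (?w * (?w * ?w)) = ?w"
    using root_pt_power4[of j] by (simp add: eval_nat_numeral)
  then have w': "?w * (?w * (?w * (?w * z))) = ?w * z" for z
    by (metis mult.assoc)
  show ?thesis
    by (simp add: proj_def times_ur_def power2_eq_square power3_eq_cube algebra_simps w w')
qed

sublocale proj: comm_ring_hom "proj j" for j
  by unfold_locales (simp_all add: proj_0 proj_1 proj_add proj_mult)

sublocale proj_poly: map_poly_comm_ring_hom "proj j" for j ..

lemma proj_ur_of: "proj j (ur_of a) = a"
  by (simp add: proj_def ur_of_def)

lemma proj_u: "proj j ur_u = root_pt j"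
  by (simp add: proj_def ur_u_def)

lemmas proj_simps = proj_0 proj_1 proj_add proj_mult proj.hom_minus proj.hom_power proj_ur_of proj_u

lemma index_cases: "j \<in> {1..4::nat} \<longleftrightarrow> j = 1 \<or> j = 2 \<or> j = 3 \<or> j = 4"
  by auto

text \<open>The \<eta>'s are the Lagrange basis polynomials of the four nodes; among the three cube
  roots of unity the zeros come from 1 + \<xi> + \<xi>^2 = 0.\<close>

lemma proj_eta:
  assumes "j \<in> {1..4}" "k \<in> {1..4}"
  shows "proj k (eta \<xi> j) = (if j = k then 1 else 0)"
  using assms three_nonzero unfolding index_cases
  by (elim disjE; simp add: eta_def proj_simps root_pt_def cube; simp add: xi_sq xi_powers algebra_simps)

text \<open>The value at 0 is the constant coefficient. The other three values form a discrete
  Fourier transform of length 3 of the remaining coefficients, and \<open>inv\<close> is the inverse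
  transform up to the factor 3.\<close>

lemma ur_eqI:
  assumes "\<And>j. j \<in> {1..4} \<Longrightarrow> proj j x = proj j y"
  shows "x = y"
proof -
  obtain a0 a1 a2 a3 where x: "x = UR a0 a1 a2 a3" by (cases x)
  obtain b0 b1 b2 b3 where y: "y = UR b0 b1 b2 b3" by (cases y)
  have e0: "a0 = b0"
    using assms[of 1] by (simp add: proj_def x y root_pt_def)
  have e1: "a1 + a2 + a3 = b1 + b2 + b3"
    using assms[of 2] e0 by (simp add: proj_def x y root_pt_def algebra_simps)
  have e2: "a1 * \<xi> ^ 2 + a2 * \<xi> + a3 = b1 * \<xi> ^ 2 + b2 * \<xi> + b3"
    using assms[of 3] e0 by (simp add: proj_def x y root_pt_def xi_powers add.assoc)
  have e3: "a1 * \<xi> + a2 * \<xi> ^ 2 + a3 = b1 * \<xi> + b2 * \<xi> ^ 2 + b3"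
    using assms[of 4] e0 by (simp add: proj_def x y root_pt_def cube add.assoc)
  have inv: "3 * c1 = (c1 + c2 + c3) + \<xi> * (c1 * \<xi> ^ 2 + c2 * \<xi> + c3) +
        \<xi> ^ 2 * (c1 * \<xi> + c2 * \<xi> ^ 2 + c3)"
      "3 * c2 = (c1 + c2 + c3) + \<xi> ^ 2 * (c1 * \<xi> ^ 2 + c2 * \<xi> + c3) +
        \<xi> * (c1 * \<xi> + c2 * \<xi> ^ 2 + c3)"
      "3 * c3 = (c1 + c2 + c3) + (c1 * \<xi> ^ 2 + c2 * \<xi> + c3) +
        (c1 * \<xi> + c2 * \<xi> ^ 2 + c3)" for c1 c2 c3
    unfolding xi_sq by (simp_all add: algebra_simps xi_powers)
  have "3 * a1 = 3 * b1" "3 * a2 = 3 * b2" "3 * a3 = 3 * b3"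
    by (simp_all only: inv[where ?c1.0 = a1 and ?c2.0 = a2 and ?c3.0 = a3]
        inv[where ?c1.0 = b1 and ?c2.0 = b2 and ?c3.0 = b3] e1 e2 e3)
  then show ?thesis using e0 three_nonzero by (simp add: x y)
qed

text \<open>u^3 takes the value 0 at the first root and 1 at the three cube roots of unity.\<close>

lemma proj_const: "j \<in> {1..4} \<Longrightarrow> proj j (1 - 2 * ur_u ^ 3) = comp_const j"
proof -
  have two: "proj j 2 = 2" using proj_add[of j 1 1] by (simp add: proj_1)
  then show "j \<in> {1..4} \<Longrightarrow> proj j (1 - 2 * ur_u ^ 3) = comp_const j"
    unfolding index_cases
    by (elim disjE) (simp_all add: proj_simps two root_pt_def comp_const_def cube xi_powers)
qed

lemma sum_indices: "(\<Sum>j=1..4. f j) = f 1 + f 2 + f 3 + f (4::nat)"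
  by (simp add: eval_nat_numeral)

lemma proj_sum_eta:
  "k \<in> {1..4} \<Longrightarrow> proj k (eta \<xi> 1 * ur_of (x 1) + eta \<xi> 2 * ur_of (x 2) +
    eta \<xi> 3 * ur_of (x 3) + eta \<xi> 4 * ur_of (x 4)) = x k"
  unfolding index_cases by (elim disjE) (simp_all add: proj_simps proj_eta)

section \<open>Splitting polynomials\<close>

lemma poly_eqI_proj:
  assumes "\<And>j. j \<in> {1..4} \<Longrightarrow> map_poly (proj j) f = map_poly (proj j) q"
  shows "f = q"
proof (rule poly_eqI)
  fix i
  show "coeff f i = coeff q i"
    using arg_cong[OF assms, of _ "\<lambda>p. coeff p i"] by (intro ur_eqI) (simp add: coeff_map_poly)
qed

lemma proj_poly_eta:
  assumes "j \<in> {1..4}" "k \<in> {1..4}"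
  shows "map_poly (proj k) (eta_poly \<xi> j q) = (if j = k then q else 0)"
proof -
  have "ur_of 0 = (0 :: 'a ur)" by (simp add: ur_of_def zero_ur_def)
  then show ?thesis
    using assms by (intro poly_eqI)
      (simp add: eta_poly_def coeff_map_poly proj_mult proj_ur_of proj_eta)
qed

lemma proj_poly_sum: "k \<in> {1..4} \<Longrightarrow> map_poly (proj k) (eta_poly_sum \<xi> q) = q k"
  unfolding eta_poly_sum_def sum_indices index_cases
  by (elim disjE) (simp_all add: proj_poly.hom_add proj_poly_eta)

lemma eta_poly_sum_mult: "eta_poly_sum \<xi> q * eta_poly_sum \<xi> r = eta_poly_sum \<xi> (\<lambda>j. q j * r j)"
  by (rule poly_eqI_proj) (simp add: proj_poly_sum proj_poly.hom_mult)

lemma eta_poly_sum_cong: "(\<And>j. j \<in> {1..4} \<Longrightarrow> q j = r j) \<Longrightarrow> eta_poly_sum \<xi> q = eta_poly_sum \<xi> r"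
  by (simp add: eta_poly_sum_def)

lemma proj_poly_xn_minus:
  assumes "j \<in> {1..4}"
  shows "map_poly (proj j) (xn_minus (1 - 2 * ur_u ^ 3) n) = xn_minus (comp_const j) n"
proof -
  have "map_poly (proj j) (xn_minus l n) = xn_minus (proj j l) n" for l
    by (rule poly_eqI) (auto simp: coeff_map_poly coeff_xn_minus proj.hom_minus proj_0 proj_1)
  then show ?thesis unfolding proj_const[OF assms, symmetric] .
qed

lemma eta_poly_eq_smult:
  assumes "j \<in> {1..4}"
  shows "eta_poly \<xi> j (q j) = smult (eta \<xi> j) (eta_poly_sum \<xi> q)"
proof (rule poly_eqI_proj)
  fix k :: nat assume k: "k \<in> {1..4}"
  have "map_poly (proj k) (smult (eta \<xi> j) (eta_poly_sum \<xi> q)) =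
      smult (proj k (eta \<xi> j)) (map_poly (proj k) (eta_poly_sum \<xi> q))"
    by (rule poly_eqI) (simp add: coeff_map_poly proj_0 proj_mult)
  then show "map_poly (proj k) (eta_poly \<xi> j (q j)) =
      map_poly (proj k) (smult (eta \<xi> j) (eta_poly_sum \<xi> q))"
    using assms k by (simp add: proj_poly_eta proj_poly_sum proj_eta)
qed

text \<open>Four generators collapse to one: by orthogonality, multiplying the sum by an idempotent
  cuts out its j-th summand, and the summands add up to the sum.\<close>

lemma code_gen_eta_polys:
  "code_gen l n ((\<lambda>j. eta_poly \<xi> j (q j)) ` {1..4}) = code_gen l n {eta_poly_sum \<xi> q}"
proof -
  let ?m = "xn_minus l n" and ?E = "(\<lambda>j. eta_poly \<xi> j (q j)) ` {1..4}"
  have "module.span (*) (insert ?m ?E) = module.span (*) {?m, eta_poly_sum \<xi> q}"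
  proof (rule antisym; rule ideal_span_minimal[OF _ ideal_subspace_span])
    have "eta_poly \<xi> j (q j) \<in> module.span (*) {?m, eta_poly_sum \<xi> q}" if "j \<in> {1..4}" for j
      using ideal_span_scale[OF ideal_span_base, of "eta_poly_sum \<xi> q" _ "[:eta \<xi> j:]"]
      by (simp add: eta_poly_eq_smult[of j q, OF that])
    then show "insert ?m ?E \<subseteq> module.span (*) {?m, eta_poly_sum \<xi> q}"
      by (auto intro: ideal_span_base)
    have "eta_poly_sum \<xi> q \<in> module.span (*) (insert ?m ?E)"
      unfolding eta_poly_sum_def by (intro ideal_span_sum ideal_span_base) auto
    then show "{?m, eta_poly_sum \<xi> q} \<subseteq> module.span (*) (insert ?m ?E)"
      by (auto intro: ideal_span_base)
  qed
  then show ?thesis by (simp add: code_gen_def)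
qed

text \<open>The four Bezout identities assemble into one over R, and then any common divisor divides
  1.\<close>

lemma is_gcd_eta_poly_sum:
  fixes r s :: "nat \<Rightarrow> 'a poly"
  assumes "\<And>j. j \<in> {1..4} \<Longrightarrow> r j * f j + s j * h j = 1"
  shows "is_gcd 1 (eta_poly_sum \<xi> f) (eta_poly_sum \<xi> h)"
proof -
  have "eta_poly_sum \<xi> r * eta_poly_sum \<xi> f + eta_poly_sum \<xi> s * eta_poly_sum \<xi> h = 1"
    by (rule poly_eqI_proj) (simp add: proj_poly.hom_add proj_poly.hom_mult proj_poly_sum assms)
  then show ?thesis
    unfolding is_gcd_def by (metis dvd_add dvd_mult one_dvd)
qed

section \<open>Splitting codes\<close>

text \<open>Phrased through projections so that membership is four independent conditions; the sum
  form comes back through \<open>join\<close>, which inverts the projections.\<close>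

definition glue :: "nat \<Rightarrow> (nat \<Rightarrow> 'a vec set) \<Rightarrow> 'a ur vec set" where
  "glue n M = {c \<in> carrier_vec n. \<forall>j\<in>{1..4}. map_vec (proj j) c \<in> M j}"

definition join :: "(nat \<Rightarrow> 'a vec) \<Rightarrow> 'a ur vec" where
  "join x = eta_vec \<xi> 1 (x 1) + eta_vec \<xi> 2 (x 2) + eta_vec \<xi> 3 (x 3) + eta_vec \<xi> 4 (x 4)"

lemma glue_cong: "(\<And>j. j \<in> {1..4} \<Longrightarrow> M j = N j) \<Longrightarrow> glue n M = glue n N"
  by (simp add: glue_def)

lemma vec_eqI_proj:
  assumes "v \<in> carrier_vec n" "w \<in> carrier_vec n"
    and "\<And>j. j \<in> {1..4} \<Longrightarrow> map_vec (proj j) v = map_vec (proj j) w"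
  shows "v = w"
proof (rule eq_vecI)
  fix i assume i: "i < dim_vec w"
  have "proj j (v $ i) = proj j (w $ i)" if "j \<in> {1..4}" for j
    using arg_cong[OF assms(3)[OF that], of "\<lambda>u. u $ i"] i assms(1,2) by simp
  then show "v $ i = w $ i" by (rule ur_eqI)
qed (use assms in simp)

lemma eta_vec_carrier: "x \<in> carrier_vec n \<Longrightarrow> eta_vec \<xi> j x \<in> carrier_vec n"
  by (simp add: eta_vec_def)

lemma join_carrier:
  "(\<And>j. j \<in> {1..4} \<Longrightarrow> x j \<in> carrier_vec n) \<Longrightarrow> join x \<in> carrier_vec n"
  by (simp add: join_def eta_vec_carrier)

lemma proj_join:
  assumes k: "k \<in> {1..4}" and x: "\<And>j. j \<in> {1..4} \<Longrightarrow> x j \<in> carrier_vec n"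
  shows "map_vec (proj k) (join x) = x k"
proof (rule eq_vecI)
  have c: "x 1 \<in> carrier_vec n" "x 2 \<in> carrier_vec n" "x 3 \<in> carrier_vec n" "x 4 \<in> carrier_vec n"
    "x k \<in> carrier_vec n"
    using x k by auto
  then show "dim_vec (map_vec (proj k) (join x)) = dim_vec (x k)"
    by (simp add: join_def eta_vec_def)
  fix i assume "i < dim_vec (x k)"
  then show "map_vec (proj k) (join x) $ i = x k $ i"
    using c proj_sum_eta[OF k, of "\<lambda>j. x j $ i"] by (simp add: join_def eta_vec_def add.assoc)
qed

lemma join_proj: "c \<in> carrier_vec n \<Longrightarrow> join (\<lambda>j. map_vec (proj j) c) = c"
  by (rule vec_eqI_proj) (auto intro!: join_carrier proj_join)

text \<open>A word determines its four coordinate vectors, so the existential in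
  \<open>component\<close> has only the projections of the word as witnesses.\<close>

lemma component_eq_image:
  assumes C: "C \<subseteq> carrier_vec n" and j: "j \<in> {1..4}"
  shows "component \<xi> n C j = map_vec (proj j) ` C"
proof safe
  fix y assume "y \<in> component \<xi> n C j"
  then obtain x where x: "y = x j" "\<forall>k\<in>{1..4}. x k \<in> carrier_vec n" "join x \<in> C"
    by (auto simp: component_def join_def)
  then have "y = map_vec (proj j) (join x)" using proj_join[OF j, of x n] by simp
  then show "y \<in> map_vec (proj j) ` C" using x by blast
next
  fix c assume c: "c \<in> C"
  then have "c \<in> carrier_vec n" using C by blast
  then have "join (\<lambda>j. map_vec (proj j) c) = c" "\<forall>k\<in>{1..4}. map_vec (proj k) c \<in> carrier_vec n"
    by (simp_all add: join_proj)
  then show "map_vec (proj j) c \<in> component \<xi> n C j"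
    unfolding component_def join_def mem_Collect_eq using c
    by (intro exI[of _ "\<lambda>j. map_vec (proj j) c"]) simp
qed

text \<open>The coordinates of a glued word come from unrelated codewords. Scaling each by its
  idempotent keeps just the wanted coordinate, so linearity over R already forces the product
  structure.\<close>

lemma linear_code_eq_glue:
  assumes C: "linear_code n C"
  shows "C = glue n (component \<xi> n C)"
proof -
  have sub: "C \<subseteq> carrier_vec n" using C by (simp add: linear_code_def)
  have "c \<in> C" if c: "c \<in> glue n (component \<xi> n C)" for c
  proof -
    have "\<forall>j\<in>{1..4}. \<exists>d\<in>C. map_vec (proj j) c = map_vec (proj j) d"
      using c by (auto simp: glue_def component_eq_image[OF sub])
    then obtain d where d: "\<And>j. j \<in> {1..4} \<Longrightarrow> d j \<in> C"
      "\<And>j. j \<in> {1..4} \<Longrightarrow> map_vec (proj j) c = map_vec (proj j) (d j)" by metis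
    let ?e = "eta \<xi> 1 \<cdot>\<^sub>v d 1 + eta \<xi> 2 \<cdot>\<^sub>v d 2 + eta \<xi> 3 \<cdot>\<^sub>v d 3 + eta \<xi> 4 \<cdot>\<^sub>v d 4"
    have e: "?e \<in> C" using C d(1) by (simp add: linear_code_def)
    have dc: "d 1 \<in> carrier_vec n" "d 2 \<in> carrier_vec n" "d 3 \<in> carrier_vec n" "d 4 \<in> carrier_vec n"
      using d(1) sub by auto
    have "c = ?e"
    proof (rule vec_eqI_proj)
      fix k :: nat assume k: "k \<in> {1..4}"
      have "map_vec (proj k) ?e = map_vec (proj k) (d k)"
        using k dc unfolding index_cases
        by (intro eq_vecI) (auto simp: proj_add proj_mult proj_eta)
      then show "map_vec (proj k) c = map_vec (proj k) ?e" using d(2)[OF k] by simp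
    qed (use c e sub in \<open>auto simp: glue_def\<close>)
    then show ?thesis using e by simp
  qed
  then show ?thesis
    using sub by (auto simp: glue_def component_eq_image[OF sub])
qed

section \<open>Codes glued from four given codes\<close>

context
  fixes n :: nat and M :: "nat \<Rightarrow> 'a vec set"
  assumes carrier: "\<And>j. j \<in> {1..4} \<Longrightarrow> M j \<subseteq> carrier_vec n"
    and zero: "\<And>j. j \<in> {1..4} \<Longrightarrow> 0\<^sub>v n \<in> M j"
begin

lemma join_in_glue:
  assumes "\<And>j. j \<in> {1..4} \<Longrightarrow> x j \<in> M j"
  shows "join x \<in> glue n M"
proof -
  have x: "x j \<in> carrier_vec n" if "j \<in> {1..4}" for j
    using assms[OF that] carrier[OF that] by blast
  have "map_vec (proj j) (join x) \<in> M j" if "j \<in> {1..4}" for j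
    using assms[OF that] proj_join[OF that x] by simp
  then show ?thesis using join_carrier[of x n] x by (simp add: glue_def)
qed

text \<open>A word of \<open>M j\<close> lifts to the glued code by padding the other coordinates
  with the zero word.\<close>

lemma component_glue:
  assumes j: "j \<in> {1..4}"
  shows "component \<xi> n (glue n M) j = M j"
proof -
  have "y \<in> map_vec (proj j) ` glue n M" if y: "y \<in> M j" for y
  proof -
    let ?x = "(\<lambda>_. 0\<^sub>v n)(j := y)"
    have x: "?x k \<in> M k" if "k \<in> {1..4}" for k using that y zero by simp
    then have "map_vec (proj j) (join ?x) = y"
      using proj_join[OF j, of ?x n] carrier by auto
    then show ?thesis using join_in_glue[of ?x] x by (metis imageI)
  qed
  then show ?thesis
    using j by (subst component_eq_image) (auto simp: glue_def)
qed

lemma is_direct_sum4_glue: "is_direct_sum4 (glue n M) (\<lambda>j. eta_vec \<xi> j ` M j)"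
proof -
  have rep: "\<exists>x. (\<forall>j\<in>{1..4}. x j \<in> M j \<and> m j = eta_vec \<xi> j (x j)) \<and> m 1 + m 2 + m 3 + m 4 = join x"
    if "\<forall>j\<in>{1..4}. m j \<in> eta_vec \<xi> j ` M j" for m
  proof -
    have "\<forall>j\<in>{1..4}. \<exists>y. y \<in> M j \<and> m j = eta_vec \<xi> j y" using that by auto
    then obtain x where "\<forall>j\<in>{1..4}. x j \<in> M j \<and> m j = eta_vec \<xi> j (x j)" by metis
    then show ?thesis by (intro exI[of _ x]) (simp add: join_def)
  qed
  have "glue n M = {m 1 + m 2 + m 3 + m 4 | m. \<forall>j\<in>{1..4::nat}. m j \<in> eta_vec \<xi> j ` M j}"
  proof safe
    fix c assume c: "c \<in> glue n M"
    then have "c = join (\<lambda>j. map_vec (proj j) c)" using join_proj[of c n] by (simp add: glue_def)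
    then show "\<exists>m. c = m 1 + m 2 + m 3 + m 4 \<and> (\<forall>j\<in>{1..4::nat}. m j \<in> eta_vec \<xi> j ` M j)"
      using c unfolding join_def glue_def
      by (intro exI[of _ "\<lambda>j. eta_vec \<xi> j (map_vec (proj j) c)"]) auto
  next
    fix m assume "\<forall>j\<in>{1..4::nat}. m j \<in> eta_vec \<xi> j ` M j"
    then obtain x where "\<forall>j\<in>{1..4}. x j \<in> M j" "m 1 + m 2 + m 3 + m 4 = join x"
      using rep[of m] by blast
    then show "m 1 + m 2 + m 3 + m 4 \<in> glue n M" using join_in_glue[of x] by simp
  qed
  moreover have "\<forall>j\<in>{1..4}. m j = m' j"
    if m: "\<forall>j\<in>{1..4}. m j \<in> eta_vec \<xi> j ` M j" and m': "\<forall>j\<in>{1..4}. m' j \<in> eta_vec \<xi> j ` M j"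
      and eq: "m 1 + m 2 + m 3 + m 4 = m' 1 + m' 2 + m' 3 + m' 4" for m m'
  proof
    fix j :: nat assume j: "j \<in> {1..4}"
    obtain x where x: "\<forall>j\<in>{1..4}. x j \<in> M j \<and> m j = eta_vec \<xi> j (x j)" "m 1 + m 2 + m 3 + m 4 = join x"
      using rep[OF m] by blast
    obtain x' where x': "\<forall>j\<in>{1..4}. x' j \<in> M j \<and> m' j = eta_vec \<xi> j (x' j)"
      "m' 1 + m' 2 + m' 3 + m' 4 = join x'"
      using rep[OF m'] by blast
    have "x k \<in> carrier_vec n" "x' k \<in> carrier_vec n" if "k \<in> {1..4}" for k
      using x(1) x'(1) carrier[OF that] that by blast+
    then have "map_vec (proj j) (join x) = x j" "map_vec (proj j) (join x') = x' j"
      using proj_join[OF j, of x n] proj_join[OF j, of x' n] by blast+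
    moreover have "join x = join x'" using x(2) x'(2) eq by simp
    ultimately show "m j = m' j" using x(1) x'(1) j by simp
  qed
  ultimately show ?thesis unfolding is_direct_sum4_def by blast
qed

text \<open>\<open>PiE\<close> fixes families outside the four indices, where \<open>join\<close>
  never looks, so that words and families correspond one to one.\<close>

lemma card_glue: "card (glue n M) = (\<Prod>j=1..4. card (M j))"
proof -
  have "bij_betw (\<lambda>c. \<lambda>j\<in>{1..4}. map_vec (proj j) c) (glue n M) (PiE {1..4} M)"
  proof (rule bij_betw_byWitness[where f' = join])
    have "join (\<lambda>j\<in>{1..4}. map_vec (proj j) c) = join (\<lambda>j. map_vec (proj j) c)" for c :: "'a ur vec"
      by (simp add: join_def)
    then show "\<forall>c\<in>glue n M. join (\<lambda>j\<in>{1..4}. map_vec (proj j) c) = c"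
      by (auto simp: glue_def join_proj)
    show "\<forall>x\<in>PiE {1..4} M. (\<lambda>j\<in>{1..4}. map_vec (proj j) (join x)) = x"
    proof
      fix x assume x: "x \<in> PiE {1..4} M"
      then have "x j \<in> carrier_vec n" if "j \<in> {1..4}" for j
        using carrier that by (meson PiE_mem subsetD)
      then show "(\<lambda>j\<in>{1..4}. map_vec (proj j) (join x)) = x"
        using x proj_join[of _ x n] by (auto simp: fun_eq_iff restrict_def PiE_def extensional_def)
    qed
    show "join ` PiE {1..4} M \<subseteq> glue n M"
      by (intro image_subsetI join_in_glue) (rule PiE_mem)
  qed (auto simp: glue_def)
  then show ?thesis by (simp add: bij_betw_same_card card_PiE)
qed

text \<open>Projections commute with the inner product, and an element of R vanishes iff its four
  projections do. Orthogonality in one coordinate is tested by lifting a word of \<open>M j\<close>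
  to the glued code.\<close>

lemma dual_code_glue: "dual_code n (glue n M) = glue n (\<lambda>j. dual_code n (M j))"
proof -
  have proj_scalar: "proj j (v \<bullet> c) = map_vec (proj j) v \<bullet> map_vec (proj j) c"
    if "v \<in> carrier_vec n" "c \<in> carrier_vec n" for j v c
    using that by (simp add: scalar_prod_def proj.hom_sum proj_mult)
  have "map_vec (proj j) v \<bullet> y = 0"
    if v: "v \<in> carrier_vec n" "\<And>c. c \<in> glue n M \<Longrightarrow> v \<bullet> c = 0" and j: "j \<in> {1..4}" and y: "y \<in> M j"
    for v j y
  proof -
    have "y \<in> map_vec (proj j) ` glue n M"
      using component_glue[OF j] component_eq_image[of "glue n M" n j] j y by (auto simp: glue_def)
    then obtain c where c: "c \<in> glue n M" "y = map_vec (proj j) c" by blast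
    then have "c \<in> carrier_vec n" by (simp add: glue_def)
    then show ?thesis using proj_scalar[OF v(1), of c j] v(2)[OF c(1)] c(2) by (simp add: proj_0)
  qed
  moreover have "v \<bullet> c = 0"
    if v: "v \<in> carrier_vec n" "\<forall>j\<in>{1..4}. map_vec (proj j) v \<in> dual_code n (M j)"
      and c: "c \<in> glue n M" for v c
  proof (rule ur_eqI)
    fix j :: nat assume "j \<in> {1..4}"
    then show "proj j (v \<bullet> c) = proj j 0"
      using v c by (auto simp: glue_def dual_code_def proj_scalar proj_0)
  qed
  ultimately show ?thesis
    by (auto simp: glue_def[of n "\<lambda>j. dual_code n (M j)"]) (auto simp: dual_code_def)
qed

end

section \<open>Generated codes over R and their generators\<close>

lemma poly_of_code_proj: "poly_of_code (map_vec (proj j) c) = map_poly (proj j) (poly_of_code c)"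
  by (intro poly_eqI) (simp add: coeff_poly_of_code coeff_map_poly proj_0)

text \<open>Cofactors found separately in the four coordinates are assembled by
  \<open>eta_poly_sum\<close> into cofactors over R; the converse is projection.\<close>

lemma code_gen_eq_glue:
  "code_gen (1 - 2 * ur_u ^ 3) n {s} =
    glue n (\<lambda>j. code_gen (comp_const j) n {map_poly (proj j) s})"
proof -
  let ?m = "xn_minus (1 - 2 * ur_u ^ 3 :: 'a ur) n"
  have "f \<in> module.span (*) {?m, s} \<longleftrightarrow>
      (\<forall>j\<in>{1..4}. map_poly (proj j) f \<in>
        module.span (*) {xn_minus (comp_const j) n, map_poly (proj j) s})" for f
  proof
    assume "f \<in> module.span (*) {?m, s}"
    then obtain a b where f: "f = a * ?m + b * s" unfolding mem_span_pair by blast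
    have "map_poly (proj j) f = map_poly (proj j) a * xn_minus (comp_const j) n +
        map_poly (proj j) b * map_poly (proj j) s" if "j \<in> {1..4}" for j
      using that by (simp add: f proj_poly.hom_add proj_poly.hom_mult proj_poly_xn_minus)
    then show "\<forall>j\<in>{1..4}. map_poly (proj j) f \<in>
        module.span (*) {xn_minus (comp_const j) n, map_poly (proj j) s}"
      unfolding mem_span_pair by blast
  next
    assume "\<forall>j\<in>{1..4}. map_poly (proj j) f \<in>
        module.span (*) {xn_minus (comp_const j) n, map_poly (proj j) s}"
    then have "\<forall>j\<in>{1..4}. \<exists>a b. map_poly (proj j) f =
        a * xn_minus (comp_const j) n + b * map_poly (proj j) s"
      by (simp add: mem_span_pair)
    then obtain a b where ab: "\<And>j. j \<in> {1..4} \<Longrightarrow> map_poly (proj j) f =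
        a j * xn_minus (comp_const j) n + b j * map_poly (proj j) s"
      by metis
    have "f = eta_poly_sum \<xi> a * ?m + eta_poly_sum \<xi> b * s"
      by (rule poly_eqI_proj)
        (simp add: ab proj_poly.hom_add proj_poly.hom_mult proj_poly_xn_minus proj_poly_sum)
    then show "f \<in> module.span (*) {?m, s}" unfolding mem_span_pair by blast
  qed
  then show ?thesis
    by (auto simp: code_gen_def glue_def poly_of_code_proj)
qed

lemma code_gen_eta_poly_sum:
  "code_gen (1 - 2 * ur_u ^ 3) n {eta_poly_sum \<xi> q} = glue n (\<lambda>j. code_gen (comp_const j) n {q j})"
  unfolding code_gen_eq_glue by (rule glue_cong) (simp add: proj_poly_sum)

lemma component_code_gen:
  "j \<in> {1..4} \<Longrightarrow> component \<xi> n (code_gen (1 - 2 * ur_u ^ 3) n {eta_poly_sum \<xi> q}) j =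
    code_gen (comp_const j) n {q j}"
  unfolding code_gen_eta_poly_sum
  by (rule component_glue) (simp_all add: code_gen_subset zero_in_code_gen)

lemma eta_poly_sum_generator_unique:
  assumes n: "n \<ge> 1"
    and q: "\<And>j. j \<in> {1..4} \<Longrightarrow> monic (q j) \<and> q j dvd xn_minus (comp_const j) n"
    and r: "\<And>j. j \<in> {1..4} \<Longrightarrow> monic (r j) \<and> r j dvd xn_minus (comp_const j) n"
    and eq: "code_gen (1 - 2 * ur_u ^ 3) n {eta_poly_sum \<xi> q} =
      code_gen (1 - 2 * ur_u ^ 3) n {eta_poly_sum \<xi> r}"
    and j: "j \<in> {1..4}"
  shows "q j = r j"
proof (rule generator_unique[OF n])
  show "code_gen (comp_const j) n {r j} = code_gen (comp_const j) n {q j}"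
    using eq component_code_gen[OF j] by metis
qed (use q r j in auto)

lemma constacyclic_component:
  assumes D: "constacyclic (1 - 2 * ur_u ^ 3) n D" and n: "n \<ge> 1" and j: "j \<in> {1..4}"
  shows "constacyclic (comp_const j) n (component \<xi> n D j)"
proof -
  have lin: "D \<subseteq> carrier_vec n" "0\<^sub>v n \<in> D" "\<And>v w. v \<in> D \<Longrightarrow> w \<in> D \<Longrightarrow> v + w \<in> D"
    "\<And>a v. v \<in> D \<Longrightarrow> a \<cdot>\<^sub>v v \<in> D" "\<And>v. v \<in> D \<Longrightarrow> constashift (1 - 2 * ur_u ^ 3) v \<in> D"
    using D by (auto simp: constacyclic_def linear_code_def)
  note eq = component_eq_image[OF lin(1) j]
  have "map_vec (proj j) (0\<^sub>v n) = 0\<^sub>v n" by (intro eq_vecI) (auto simp: proj_0)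
  then have "0\<^sub>v n \<in> map_vec (proj j) ` D" using lin(2) by (metis imageI)
  moreover have "map_vec (proj j) v + map_vec (proj j) w \<in> map_vec (proj j) ` D"
    if "v \<in> D" "w \<in> D" for v w
  proof -
    have "v \<in> carrier_vec n" "w \<in> carrier_vec n" using that lin(1) by auto
    then have "map_vec (proj j) (v + w) = map_vec (proj j) v + map_vec (proj j) w"
      by (intro eq_vecI) (auto simp: proj_add)
    then show ?thesis using lin(3)[OF that] by (metis imageI)
  qed
  moreover have "a \<cdot>\<^sub>v map_vec (proj j) v \<in> map_vec (proj j) ` D" if "v \<in> D" for a v
  proof -
    \<comment> \<open>Field scalars are lifted along \<open>ur_of\<close>, a right inverse of every
      projection.\<close>
    have "map_vec (proj j) (ur_of a \<cdot>\<^sub>v v) = a \<cdot>\<^sub>v map_vec (proj j) v"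
      by (intro eq_vecI) (auto simp: proj_mult proj_ur_of)
    then show ?thesis using lin(4)[OF that] by (metis imageI)
  qed
  moreover have "constashift (comp_const j) (map_vec (proj j) v) \<in> map_vec (proj j) ` D"
    if "v \<in> D" for v
  proof -
    have "v \<in> carrier_vec n" using that lin(1) by auto
    then have "map_vec (proj j) (constashift (1 - 2 * ur_u ^ 3) v) =
        constashift (comp_const j) (map_vec (proj j) v)"
      using n by (intro eq_vecI) (auto simp: constashift_def proj_mult proj_const[OF j])
    then show ?thesis using lin(5)[OF that] by (metis imageI)
  qed
  moreover have "map_vec (proj j) ` D \<subseteq> carrier_vec n" using lin(1) by auto
  ultimately show ?thesis unfolding eq constacyclic_def linear_code_def by blast
qed

text \<open>This reduces the count of codes to counts of monic divisors. The extensional product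
  lists each quadruple once, as the code depends only on the values at 1 to 4.\<close>

lemma bij_betw_generators:
  assumes n: "n \<ge> 1"
  shows "bij_betw (\<lambda>q. code_gen (1 - 2 * ur_u ^ 3) n {eta_poly_sum \<xi> q})
    (PiE {1..4} (\<lambda>j. {q. monic q \<and> q dvd xn_minus (comp_const j) n}))
    {D. constacyclic (1 - 2 * ur_u ^ 3) n D}"
    (is "bij_betw ?F (PiE _ ?P) _")
proof (rule bij_betw_imageI)
  show "inj_on ?F (PiE {1..4} ?P)"
  proof (rule inj_onI)
    fix q r assume qr: "q \<in> PiE {1..4} ?P" "r \<in> PiE {1..4} ?P" "?F q = ?F r"
    then show "q = r"
      by (intro PiE_ext[OF qr(1,2)] eta_poly_sum_generator_unique[OF n]) auto
  qed
  show "?F ` PiE {1..4} ?P = {D. constacyclic (1 - 2 * ur_u ^ 3) n D}"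
  proof safe
    fix D :: "'a ur vec set" assume D: "constacyclic (1 - 2 * ur_u ^ 3) n D"
    have "\<forall>j\<in>{1..4}. \<exists>q. generator_poly (comp_const j) n (component \<xi> n D j) q"
      using constacyclic_generator[OF n constacyclic_component[OF D n]] by metis
    then obtain q where q: "\<And>j. j \<in> {1..4} \<Longrightarrow> generator_poly (comp_const j) n (component \<xi> n D j) (q j)"
      by metis
    let ?q = "restrict q {1..4}"
    have "D = glue n (component \<xi> n D)"
      using D by (intro linear_code_eq_glue) (simp add: constacyclic_def)
    also have "\<dots> = ?F ?q"
      unfolding code_gen_eta_poly_sum
      by (rule glue_cong) (use q in \<open>simp add: generator_poly_def\<close>)
    finally have "D = ?F ?q" .
    moreover have "?q \<in> PiE {1..4} ?P" using q by (auto simp: generator_poly_def)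
    ultimately show "D \<in> ?F ` PiE {1..4} ?P" by blast
  qed (rule constacyclic_code_gen[OF n])
qed

text \<open>Gluing loses nothing, as \<open>component\<close> recovers every factor; so equality of
  the two glued codes is equality in each coordinate. The duals may be glued since they contain the
  zero word.\<close>

lemma self_dual_glue:
  assumes "\<And>j. j \<in> {1..4} \<Longrightarrow> M j \<subseteq> carrier_vec n" "\<And>j. j \<in> {1..4} \<Longrightarrow> 0\<^sub>v n \<in> M j"
  shows "self_dual n (glue n M) \<longleftrightarrow> (\<forall>j\<in>{1..4}. self_dual n (M j))"
proof -
  have "0\<^sub>v n \<in> dual_code n (M j)" if "j \<in> {1..4}" for j
    unfolding dual_code_def using assms(1)[OF that] by (auto intro!: scalar_prod_left_zero)
  moreover have "dual_code n (M j) \<subseteq> carrier_vec n" for j by (auto simp: dual_code_def)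
  ultimately have D: "component \<xi> n (glue n (\<lambda>j. dual_code n (M j))) j = dual_code n (M j)"
    if "j \<in> {1..4}" for j
    using that by (intro component_glue) auto
  have M: "component \<xi> n (glue n M) j = M j" if "j \<in> {1..4}" for j
    using assms that by (rule component_glue)
  have "glue n M = glue n (\<lambda>j. dual_code n (M j)) \<longleftrightarrow> (\<forall>j\<in>{1..4}. M j = dual_code n (M j))"
  proof
    assume "glue n M = glue n (\<lambda>j. dual_code n (M j))"
    then show "\<forall>j\<in>{1..4}. M j = dual_code n (M j)" using D M by metis
  next
    assume "\<forall>j\<in>{1..4}. M j = dual_code n (M j)"
    then show "glue n M = glue n (\<lambda>j. dual_code n (M j))" by (intro glue_cong) blast
  qed
  moreover have "dual_code n (glue n M) = glue n (\<lambda>j. dual_code n (M j))"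
    using assms by (rule dual_code_glue)
  ultimately show ?thesis unfolding self_dual_def by metis
qed

end


theorem theorem5:
  fixes \<xi> :: "'p::prime_card mod_ring"
    and p n :: nat
    and C :: "'p mod_ring ur vec set"
    and g :: "nat \<Rightarrow> 'p mod_ring poly"
  assumes p: "p = CARD('p)" "[p = 1] (mod 3)"
    and n: "n \<ge> 1"
    and \<xi>: "primitive_root_of_unity 3 \<xi>"
    and C: "constacyclic (1 - 2 * ur_u ^ 3) n C"
    and g: "\<And>i. i \<in> {1..4} \<Longrightarrow> generator_poly (comp_const i) n (component \<xi> n C i) (g i)"
  shows
    \<comment> \<open>the decomposition of \<open>C\<close>\<close>
    "is_direct_sum4 C (\<lambda>j. eta_vec \<xi> j ` component \<xi> n C j) \<and>
     cyclic n (component \<xi> n C 1) \<and> (\<forall>j\<in>{2..4}. negacyclic n (component \<xi> n C j))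
     \<and>
     \<comment> \<open>(i)\<close>
     C = code_gen (1 - 2 * ur_u ^ 3) n ((\<lambda>j. eta_poly \<xi> j (g j)) ` {1..4}) \<and>
     C = code_gen (1 - 2 * ur_u ^ 3) n {eta_poly_sum \<xi> g} \<and>
     (\<forall>q. (\<forall>i\<in>{1..4}. monic (q i) \<and> q i dvd xn_minus (comp_const i) n) \<and>
          C = code_gen (1 - 2 * ur_u ^ 3) n {eta_poly_sum \<xi> q} \<longrightarrow>
          eta_poly_sum \<xi> q = eta_poly_sum \<xi> g)
     \<and>
     \<comment> \<open>(ii)\<close>
     card C = p ^ (4 * n - (\<Sum>i=1..4. degree (g i)))
     \<and>
     \<comment> \<open>(iii)\<close>
     (\<forall>h. (\<forall>i\<in>{1..4}. g i * h i = xn_minus (comp_const i) n) \<longrightarrow>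
          eta_poly_sum \<xi> g * eta_poly_sum \<xi> h = xn_minus (1 - 2 * ur_u ^ 3) n)
     \<and>
     \<comment> \<open>(iv)\<close>
     (\<forall>h f. (\<forall>i\<in>{1..4}. g i * h i = xn_minus (comp_const i) n) \<and>
            (\<forall>i\<in>{1..4}. gcd (f i) (h i) = 1) \<longrightarrow>
          is_gcd 1 (eta_poly_sum \<xi> f) (eta_poly_sum \<xi> h) \<and>
          C = code_gen (1 - 2 * ur_u ^ 3) n {eta_poly_sum \<xi> g * eta_poly_sum \<xi> f})
     \<and>
     \<comment> \<open>(v)\<close>
     is_direct_sum4 (dual_code n C) (\<lambda>j. eta_vec \<xi> j ` dual_code n (component \<xi> n C j))
     \<and>
     \<comment> \<open>(vi)\<close>
     (\<forall>h. (\<forall>i\<in>{1..4}. g i * h i = xn_minus (comp_const i) n) \<longrightarrow>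
          dual_code n C =
            code_gen (1 - 2 * ur_u ^ 3) n {eta_poly_sum \<xi> (\<lambda>i. reflect_poly (h i))})
     \<and>
     \<comment> \<open>(vii)\<close>
     card (dual_code n C) = p ^ (\<Sum>i=1..4. degree (g i))
     \<and>
     \<comment> \<open>(viii)\<close>
     (coprime n p \<longrightarrow>
        card {D :: 'p mod_ring ur vec set. constacyclic (1 - 2 * ur_u ^ 3) n D} =
          2 ^ card {q :: 'p mod_ring poly. monic q \<and> irreducible q \<and> q dvd xn_minus 1 n} *
          8 ^ card {q :: 'p mod_ring poly. monic q \<and> irreducible q \<and> q dvd xn_minus (- 1) n})
     \<and>
     \<comment> \<open>(ix)\<close>
     (self_dual n C \<longleftrightarrow> (\<forall>j\<in>{1..4}. self_dual n (component \<xi> n C j)))"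
proof -
  interpret cube_root \<xi> by unfold_locales (rule \<xi>)
  let ?R = "1 - 2 * ur_u ^ 3 :: 'p mod_ring ur" and ?M = "component \<xi> n C"
  have p_card: "CARD('p mod_ring) = p" using p by simp
  have lin: "linear_code n C" using C by (simp add: constacyclic_def)
  have gen: "monic (g i)" "g i dvd xn_minus (comp_const i) n" "?M i = code_gen (comp_const i) n {g i}"
    if "i \<in> {1..4}" for i
    using g[OF that] by (auto simp: generator_poly_def)
  have sq: "comp_const i * comp_const i = (1 :: 'p mod_ring)" for i
    by (simp add: comp_const_def)
  have M: "?M i \<subseteq> carrier_vec n" "0\<^sub>v n \<in> ?M i" if "i \<in> {1..4}" for i
    using gen(3)[OF that] by (simp_all add: code_gen_subset zero_in_code_gen)
  have glue: "C = glue n ?M" using lin by (rule linear_code_eq_glue)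
  have deg: "degree (g i) \<le> n" if "i \<in> {1..4}" for i
    using dvd_imp_degree_le[OF gen(2)[OF that] xn_minus_nonzero[OF n]] by (simp add: degree_xn_minus[OF n])
  \<comment> \<open>Claims (v) and (vii) do not mention h, but their proofs describe the component
    duals through some choice of it.\<close>
  have cofactor: "\<exists>h. \<forall>i\<in>{1..4}. g i * h i = xn_minus (comp_const i) n"
  proof -
    have "\<forall>i\<in>{1..4}. \<exists>h. g i * h = xn_minus (comp_const i) n"
      using gen(2) by (metis dvdE)
    then show ?thesis by metis
  qed
  have dual_comp: "dual_code n (?M i) = code_gen (comp_const i) n {reflect_poly (h i)}"
    if "\<forall>i\<in>{1..4}. g i * h i = xn_minus (comp_const i) n" "i \<in> {1..4}" for h i
    unfolding gen(3)[OF that(2)] using that by (intro dual_code_gen[OF n _ sq]) blast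
  have dual: "dual_code n C = glue n (\<lambda>i. dual_code n (?M i))"
    using dual_code_glue[of ?M n, OF M] glue by simp
  have dualM: "dual_code n (?M i) \<subseteq> carrier_vec n" "0\<^sub>v n \<in> dual_code n (?M i)"
    if "i \<in> {1..4}" for i
    using cofactor dual_comp[OF _ that] code_gen_subset zero_in_code_gen by metis+

  have sum: "is_direct_sum4 C (\<lambda>j. eta_vec \<xi> j ` ?M j)"
    using is_direct_sum4_glue[of ?M n, OF M] glue by simp
  have consta: "constacyclic (comp_const i) n (?M i)" if "i \<in> {1..4}" for i
    using C n that by (rule constacyclic_component)
  have cyc: "cyclic n (?M 1)" using consta[of 1] by (simp add: comp_const_def)
  have neg: "\<forall>j\<in>{2..4}. negacyclic n (?M j)"
  proof
    fix j :: nat assume "j \<in> {2..4}"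
    then show "negacyclic n (?M j)" using consta[of j] by (auto simp: comp_const_def)
  qed
  have i2: "C = code_gen ?R n {eta_poly_sum \<xi> g}"
    unfolding code_gen_eta_poly_sum by (subst glue) (rule glue_cong, rule gen(3))
  have i1: "C = code_gen ?R n ((\<lambda>j. eta_poly \<xi> j (g j)) ` {1..4})"
    unfolding code_gen_eta_polys by (rule i2)
  have i3: "eta_poly_sum \<xi> q = eta_poly_sum \<xi> g"
    if "\<forall>i\<in>{1..4}. monic (q i) \<and> q i dvd xn_minus (comp_const i) n"
      "C = code_gen ?R n {eta_poly_sum \<xi> q}" for q
    by (intro eta_poly_sum_cong eta_poly_sum_generator_unique[OF n])
      (use that i2 gen in auto)
  have ii: "card C = p ^ (4 * n - (\<Sum>i=1..4. degree (g i)))"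
  proof -
    have "card C = (\<Prod>i=1..4. card (?M i))"
      using card_glue[of ?M n, OF M] glue by simp
    also have "\<dots> = (\<Prod>i=1..4. p ^ (n - degree (g i)))"
    proof (rule prod.cong)
      fix i :: nat assume i: "i \<in> {1..4}"
      show "card (?M i) = p ^ (n - degree (g i))"
        unfolding gen(3)[OF i] card_code_gen[OF n gen(2)[OF i]] p_card ..
    qed simp
    also have "\<dots> = p ^ (\<Sum>i=1..4. n - degree (g i))" by (simp add: power_sum)
    \<comment> \<open>The subtractions are on natural numbers, so pulling the sum out relies on each
      degree being at most n.\<close>
    also have "(\<Sum>i=1..4. n - degree (g i)) = 4 * n - (\<Sum>i=1..4. degree (g i))"
      using deg by (subst sum_subtractf_nat) auto
    finally show ?thesis .
  qed
  have iii: "eta_poly_sum \<xi> g * eta_poly_sum \<xi> h = xn_minus ?R n"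
    if "\<forall>i\<in>{1..4}. g i * h i = xn_minus (comp_const i) n" for h
    unfolding eta_poly_sum_mult
    by (rule poly_eqI_proj) (use that in \<open>simp add: proj_poly_sum proj_poly_xn_minus\<close>)
  have iv: "is_gcd 1 (eta_poly_sum \<xi> f) (eta_poly_sum \<xi> h) \<and>
      C = code_gen ?R n {eta_poly_sum \<xi> g * eta_poly_sum \<xi> f}"
    if h: "\<forall>i\<in>{1..4}. g i * h i = xn_minus (comp_const i) n"
      and f: "\<forall>i\<in>{1..4}. gcd (f i) (h i) = 1" for h f
  proof
    have "fst (bezout_coefficients (f i) (h i)) * f i +
        snd (bezout_coefficients (f i) (h i)) * h i = 1" if "i \<in> {1..4}" for i
      using f that bezout_coefficients_fst_snd[of "f i" "h i"] by simp
    then show "is_gcd 1 (eta_poly_sum \<xi> f) (eta_poly_sum \<xi> h)" by (rule is_gcd_eta_poly_sum)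
    have "?M i = code_gen (comp_const i) n {g i * f i}" if "i \<in> {1..4}" for i
      unfolding gen(3)[OF that] using code_gen_unit_multiple[of "g i" "h i" _ n "f i"] h f that by metis
    then show "C = code_gen ?R n {eta_poly_sum \<xi> g * eta_poly_sum \<xi> f}"
      unfolding eta_poly_sum_mult code_gen_eta_poly_sum by (subst glue) (rule glue_cong)
  qed
  have v: "is_direct_sum4 (dual_code n C) (\<lambda>j. eta_vec \<xi> j ` dual_code n (?M j))"
    unfolding dual using dualM by (rule is_direct_sum4_glue)
  have vi: "dual_code n C = code_gen ?R n {eta_poly_sum \<xi> (\<lambda>i. reflect_poly (h i))}"
    if "\<forall>i\<in>{1..4}. g i * h i = xn_minus (comp_const i) n" for h
    unfolding dual code_gen_eta_poly_sum by (rule glue_cong) (rule dual_comp[OF that])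
  have vii: "card (dual_code n C) = p ^ (\<Sum>i=1..4. degree (g i))"
  proof -
    obtain h where h: "\<forall>i\<in>{1..4}. g i * h i = xn_minus (comp_const i) n" using cofactor by blast
    have "card (dual_code n (?M i)) = p ^ degree (g i)" if i: "i \<in> {1..4}" for i
    proof -
      have gh: "g i * h i = xn_minus (comp_const i) n" using h i by blast
      then have hm: "h i dvd xn_minus (comp_const i) n" by (metis dvd_triv_right)
      have c0: "comp_const i \<noteq> (0 :: 'p mod_ring)" by (simp add: comp_const_def)
      have nz: "g i \<noteq> 0" "h i \<noteq> 0" using gh xn_minus_nonzero[OF n, of "comp_const i"] by auto
      have "degree (g i) + degree (h i) = n"
        unfolding degree_mult_eq[OF nz, symmetric] gh by (rule degree_xn_minus[OF n])
      then have "n - degree (reflect_poly (h i)) = degree (g i)"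
        using dvd_xn_minus_coeff_0[OF c0 n hm] by simp
      then show ?thesis
        unfolding dual_comp[OF h i] card_code_gen[OF n reflect_poly_dvd_xn_minus[OF sq n hm]] p_card
        by simp
    qed
    then have "(\<Prod>i=1..4. card (dual_code n (?M i))) = (\<Prod>i=1..4. p ^ degree (g i))"
      by (intro prod.cong) auto
    then show ?thesis
      unfolding dual using card_glue[of "\<lambda>i. dual_code n (?M i)" n, OF dualM] by (simp add: power_sum)
  qed
  have viii: "card {D :: 'p mod_ring ur vec set. constacyclic ?R n D} =
      2 ^ card {q :: 'p mod_ring poly. monic q \<and> irreducible q \<and> q dvd xn_minus 1 n} *
      8 ^ card {q :: 'p mod_ring poly. monic q \<and> irreducible q \<and> q dvd xn_minus (- 1) n}"
    if "coprime n p"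
  proof -
    let ?r = "\<lambda>l :: 'p mod_ring. card {q. monic q \<and> irreducible q \<and> q dvd xn_minus l n}"
    have "\<not> p dvd n"
      using that prime_card[where 'a = 'p] p(1) by (metis coprime_absorb_left coprime_commute not_prime_unit)
    then have n0: "of_nat n \<noteq> (0 :: 'p mod_ring)"
      using of_nat_0_mod_ring_dvd[of n, where 'a = 'p] p(1) by auto
    have count: "card {q. monic q \<and> q dvd xn_minus l n} = 2 ^ ?r l" if "l \<noteq> 0" for l :: "'p mod_ring"
      by (rule card_monic_divisors_squarefree[OF squarefree_xn_minus[OF n that n0]])
    have "card {D :: 'p mod_ring ur vec set. constacyclic ?R n D} =
        (\<Prod>j=1..4. card {q :: 'p mod_ring poly. monic q \<and> q dvd xn_minus (comp_const j) n})"
      using bij_betw_same_card[OF bij_betw_generators[OF n]] by (simp add: card_PiE)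
    \<comment> \<open>One cyclic component and three negacyclic ones over the same modulus: the 8 is
      2^3.\<close>
    also have "\<dots> = 2 ^ ?r 1 * (2 ^ ?r (- 1) * 2 ^ ?r (- 1) * 2 ^ ?r (- 1))"
      by (simp add: eval_nat_numeral comp_const_def count)
    also have "2 ^ ?r (- 1) * 2 ^ ?r (- 1) * 2 ^ ?r (- 1) = (8 :: nat) ^ ?r (- 1)"
      by (simp flip: power_mult_distrib)
    finally show ?thesis .
  qed
  have ix: "self_dual n C \<longleftrightarrow> (\<forall>j\<in>{1..4}. self_dual n (?M j))"
    using self_dual_glue[of ?M n, OF M] glue by simp
  show ?thesis
    using sum cyc neg i1 i2 i3 ii iii iv v vi vii viii ix by blast
qed

end
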